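(* Let $n\ge 1$ be an integer and let $\mathcal A$ be a Hopf algebra over $\mathbb C$, with comultiplication $\Delta_{\mathcal A}(a)=a_{(1)}\otimes a_{(2)}$ (Sweedler notation), counit $\varepsilon_{\mathcal A}$ and antipode $S_{\mathcal A}$. Then the free wreath product algebra $\mathcal A *_{\rm w}\mathcal A_t(n)$ admits a Hopf algebra structure whose comultiplication $\Delta$, counit $\varepsilon$ and antipode $S$ satisfy, for all $a\in\mathcal A$ and $i,j\in\{1,\dots,n\}$: $$\Delta(x_{ij})=\sum_{k=1}^n x_{ik}\otimes x_{kj},\qquad \Delta(\nu_i(a))=\sum_{k=1}^n (\nu_i\otimes\nu_k)(\Delta_{\mathcal A}(a))\,(x_{ik}\otimes 1)=\sum_{k=1}^n \nu_i(a_{(1)})x_{ik}\otimes \nu_k(a_{(2)}),$$ $$\varepsilon(x_{ij})=\delta_{ij},\qquad \varepsilon(\nu_i(a))=\varepsilon_{\mathcal A}(a),\qquad S(x_{ij})=x_{ji},\qquad S(\nu_i(a))=\sum_{k=1}^n\nu_k(S_{\mathcal A}(a))\,x_{ki}.$$ If $\mathcal A$ is a Hopf $*$-algebra, then so is $\mathcal A *_{\rm w}\mathcal A_t(n)$, with $x_{ij}^*=x_{ij}$ and $\nu_i(a)^*=\nu_i(a^* )$. If $\mathcal A$ is a CQG algebra, then $\mathcal A *_{\rm w}\mathcal A_t(n)$ is also a CQG algebra.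
   Context: All algebras are unital, over $\mathbb C$; $n\ge1$ is an integer. $\mathcal A_t(n)$ is the universal algebra with generators $(x_{ij})_{1\le i,j\le n}$ and relations, for $1\le i,j,k\le n$, $x_{ij}x_{ik}=\delta_{jk}x_{ij}$, $x_{ji}x_{ki}=\delta_{jk}x_{ji}$, $\sum_{l=1}^n x_{il}=1=\sum_{l=1}^n x_{li}$ (the Hopf algebra of the quantum permutation group). For an algebra $\mathcal A$, $\mathcal A^{*n}$ denotes the $n$-fold free product (coproduct in the category of unital algebras) of copies of $\mathcal A$, with canonical morphisms $\nu_i:\mathcal A\to\mathcal A^{*n}$, $1\le i\le n$; $*$ between algebras denotes the free product (coproduct) of unital algebras. For a Hopf algebra $\mathcal A$, the free wreath product $\mathcal A*_{\rm w}\mathcal A_t(n)$ is the quotient of the algebra $\mathcal A^{*n}*\mathcal A_t(n)$ by the two-sided ideal generated by the elements $\nu_k(a)x_{ki}-x_{ki}\nu_k(a)$, $1\le i,k\le n$, $a\in\mathcal A$. The class of an element of $\mathcal A^{*n}*\mathcal A_t(n)$ is denoted by the same symbol. A CQG algebra is a Hopf $*$-algebra that is generated as an algebra by the matrix coefficients of a family of its finite-dimensional unitary corepresentations (a matrix corepresentation $u=(u_{kl})$ satisfies $\Delta(u_{kl})=\sum_s u_{ks}\otimes u_{sl}$, $\varepsilon(u_{kl})=\delta_{kl}$; it is unitary if the matrix $u$ is unitary). *)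

theory Defs
  imports Complex_Main "HOL-Library.Poly_Mapping"
begin

section \<open>Unital complex algebras\<close>

class scaleC =
  fixes scaleC :: "complex \<Rightarrow> 'a \<Rightarrow> 'a" (infixr \<open>*\<^sub>C\<close> 75)

class complex_vector = scaleC + ab_group_add +
  assumes scaleC_add_right: "c *\<^sub>C (x + y) = c *\<^sub>C x + c *\<^sub>C y"
    and scaleC_add_left: "(c + d) *\<^sub>C x = c *\<^sub>C x + d *\<^sub>C x"
    and scaleC_scaleC: "c *\<^sub>C d *\<^sub>C x = (c * d) *\<^sub>C x"
    and scaleC_one: "1 *\<^sub>C x = x"

class complex_algebra = complex_vector + ring +
  assumes mult_scaleC_left: "(c *\<^sub>C x) * y = c *\<^sub>C (x * y)"
    and mult_scaleC_right: "x * (c *\<^sub>C y) = c *\<^sub>C (x * y)"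

(* The zero algebra is not excluded: a quotient by an ideal may be trivial a priori. *)
class complex_unital_algebra = complex_algebra + monoid_mult

global_interpretation complex_vector: vector_space "scaleC :: complex \<Rightarrow> 'a \<Rightarrow> 'a::complex_vector"
  by unfold_locales (simp_all add: scaleC_add_right scaleC_add_left scaleC_scaleC scaleC_one)

abbreviation clinear :: "('a::complex_vector \<Rightarrow> 'b::complex_vector) \<Rightarrow> bool" where
  "clinear \<equiv> Vector_Spaces.linear scaleC scaleC"

instantiation complex :: complex_unital_algebra
begin

definition scaleC_complex :: "complex \<Rightarrow> complex \<Rightarrow> complex" where
  "scaleC_complex = (*)"

instance
  by standard (simp_all add: scaleC_complex_def algebra_simps)

end

definition algebra_hom :: "('a::complex_unital_algebra \<Rightarrow> 'b::complex_unital_algebra) \<Rightarrow> bool" where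
  "algebra_hom f \<longleftrightarrow> clinear f \<and> f 1 = 1 \<and> (\<forall>x y. f (x * y) = f x * f y)"

definition unital_subalgebra :: "'a::complex_unital_algebra set \<Rightarrow> bool" where
  "unital_subalgebra B \<longleftrightarrow>
     complex_vector.subspace B \<and> 1 \<in> B \<and> (\<forall>x\<in>B. \<forall>y\<in>B. x * y \<in> B)"

definition two_sided_ideal :: "'a::ring set \<Rightarrow> bool" where
  "two_sided_ideal I \<longleftrightarrow>
     0 \<in> I \<and> (\<forall>x\<in>I. \<forall>y\<in>I. x + y \<in> I) \<and> (\<forall>x\<in>I. \<forall>a. a * x \<in> I \<and> x * a \<in> I)"

definition ideal_cong :: "'a::complex_unital_algebra set \<Rightarrow> 'a \<Rightarrow> 'a \<Rightarrow> bool" where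
  "ideal_cong R x y \<longleftrightarrow> x - y \<in> two_sided_ideal hull R"

lemma two_sided_ideal_hull: "two_sided_ideal (two_sided_ideal hull R)"
  by (rule hull_in) (auto simp: two_sided_ideal_def)

lemma ideal_0: "0 \<in> two_sided_ideal hull R"
  and ideal_add: "x \<in> two_sided_ideal hull R \<Longrightarrow> y \<in> two_sided_ideal hull R \<Longrightarrow>
    x + y \<in> two_sided_ideal hull R"
  and ideal_mult_left: "x \<in> two_sided_ideal hull R \<Longrightarrow> a * x \<in> two_sided_ideal hull R"
  and ideal_mult_right: "x \<in> two_sided_ideal hull R \<Longrightarrow> x * a \<in> two_sided_ideal hull R"
  using two_sided_ideal_hull[of R] by (auto simp: two_sided_ideal_def)

lemma ideal_scaleC:
  fixes x :: "'a::complex_unital_algebra"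
  assumes "x \<in> two_sided_ideal hull R"
  shows "c *\<^sub>C x \<in> two_sided_ideal hull R"
  using ideal_mult_left[OF assms, of "c *\<^sub>C 1"] by (simp add: mult_scaleC_left)

lemma ideal_uminus:
  fixes x :: "'a::complex_unital_algebra"
  assumes "x \<in> two_sided_ideal hull R"
  shows "- x \<in> two_sided_ideal hull R"
  using ideal_mult_left[OF assms, of "- 1"] by simp

lemma ideal_cong_refl: "ideal_cong R x x"
  by (simp add: ideal_cong_def ideal_0)

lemma ideal_cong_sym: "ideal_cong R x y \<Longrightarrow> ideal_cong R y x"
  unfolding ideal_cong_def by (drule ideal_uminus) simp

lemma ideal_cong_trans: "ideal_cong R x y \<Longrightarrow> ideal_cong R y z \<Longrightarrow> ideal_cong R x z"
  unfolding ideal_cong_def by (drule (1) ideal_add) simp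

lemma equivp_ideal_cong: "equivp (ideal_cong R)"
  by (intro equivpI reflpI sympI transpI)
    (blast intro: ideal_cong_refl ideal_cong_sym ideal_cong_trans)+

lemma ideal_cong_add:
  "ideal_cong R x x' \<Longrightarrow> ideal_cong R y y' \<Longrightarrow> ideal_cong R (x + y) (x' + y')"
  unfolding ideal_cong_def by (drule (1) ideal_add) (simp add: algebra_simps)

lemma ideal_cong_uminus: "ideal_cong R x x' \<Longrightarrow> ideal_cong R (- x) (- x')"
  unfolding ideal_cong_def by (drule ideal_uminus) simp

lemma ideal_cong_diff:
  "ideal_cong R x x' \<Longrightarrow> ideal_cong R y y' \<Longrightarrow> ideal_cong R (x - y) (x' - y')"
  using ideal_cong_add[of R x x' "- y" "- y'"] ideal_cong_uminus[of R y y'] by simp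

lemma ideal_cong_mult:
  assumes "ideal_cong R x x'" "ideal_cong R y y'"
  shows "ideal_cong R (x * y) (x' * y')"
proof -
  have "x * y - x' * y' = (x - x') * y + x' * (y - y')"
    by (simp add: algebra_simps)
  with assms show ?thesis
    by (simp add: ideal_cong_def ideal_add ideal_mult_left ideal_mult_right)
qed

lemma ideal_cong_scaleC: "ideal_cong R x x' \<Longrightarrow> ideal_cong R (c *\<^sub>C x) (c *\<^sub>C x')"
  unfolding ideal_cong_def
  by (drule ideal_scaleC[of _ _ c]) (simp add: complex_vector.scale_right_diff_distrib)


section \<open>Free algebras\<close>

instantiation poly_mapping :: (type, complex_vector) complex_vector
begin

definition scaleC_poly_mapping :: "complex \<Rightarrow> ('a \<Rightarrow>\<^sub>0 'b) \<Rightarrow> ('a \<Rightarrow>\<^sub>0 'b)" where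
  "scaleC_poly_mapping c p = Poly_Mapping.map (scaleC c) p"

lemma lookup_scaleC [simp]: "Poly_Mapping.lookup (c *\<^sub>C p) k = c *\<^sub>C Poly_Mapping.lookup p k"
  for p :: "'a \<Rightarrow>\<^sub>0 'b"
  unfolding scaleC_poly_mapping_def by transfer (simp add: when_def)

instance
  by standard
    (rule poly_mapping_eqI; simp add: lookup_add scaleC_add_right scaleC_add_left scaleC_scaleC scaleC_one)+

end

lemma scaleC_single: "c *\<^sub>C Poly_Mapping.single k v = Poly_Mapping.single k (c *\<^sub>C v)"
  by (rule poly_mapping_eqI) (simp add: lookup_single when_def)

lemma poly_mapping_scaleC_induct [case_names zero single add]:
  assumes "P 0" "\<And>k v. P (Poly_Mapping.single k v)" "\<And>p q. P p \<Longrightarrow> P q \<Longrightarrow> P (p + q)"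
  shows "P (p :: 'a \<Rightarrow>\<^sub>0 'b::comm_monoid_add)"
proof -
  have "P (\<Sum>k\<in>Poly_Mapping.keys p. Poly_Mapping.single k (Poly_Mapping.lookup p k))"
    using finite_keys[of p] by (induction rule: finite_induct) (simp_all add: assms)
  also have "(\<Sum>k\<in>Poly_Mapping.keys p. Poly_Mapping.single k (Poly_Mapping.lookup p k)) = p"
    by (rule poly_mapping_eqI)
      (auto simp: lookup_sum lookup_single when_def in_keys_iff sum.delta)
  finally show ?thesis .
qed

instance poly_mapping :: (monoid_add, complex_algebra) complex_algebra
proof
  fix c :: complex and x y :: "'a \<Rightarrow>\<^sub>0 'b"
  show "(c *\<^sub>C x) * y = c *\<^sub>C (x * y)"
  proof (induction x rule: poly_mapping_scaleC_induct)
    case (single k v)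
    then show ?case
      by (induction y rule: poly_mapping_scaleC_induct)
        (simp_all add: scaleC_single mult_single mult_scaleC_left distrib_left scaleC_add_right)
  qed (simp_all add: distrib_right scaleC_add_right)
  show "x * (c *\<^sub>C y) = c *\<^sub>C (x * y)"
  proof (induction x rule: poly_mapping_scaleC_induct)
    case (single k v)
    then show ?case
      by (induction y rule: poly_mapping_scaleC_induct)
        (simp_all add: scaleC_single mult_single mult_scaleC_right distrib_left scaleC_add_right)
  qed (simp_all add: distrib_right scaleC_add_right)
qed

instance poly_mapping :: (monoid_add, "{complex_algebra, ring_1}") complex_unital_algebra ..

(* Words in the letters 'x, as an additively written monoid, so that the convolution product
   of finitely supported functions is the product of the free algebra. *)
datatype 'x free_monoid = Word "'x list"

instantiation free_monoid :: (type) monoid_add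
begin

definition zero_free_monoid :: "'a free_monoid" where
  "zero_free_monoid = Word []"

fun plus_free_monoid :: "'a free_monoid \<Rightarrow> 'a free_monoid \<Rightarrow> 'a free_monoid" where
  "plus_free_monoid (Word v) (Word w) = Word (v @ w)"

instance
proof
  fix a b c :: "'a free_monoid"
  show "a + b + c = a + (b + c)"
    by (cases a; cases b; cases c) simp
  show "0 + a = a" "a + 0 = a"
    by (cases a; simp add: zero_free_monoid_def)+
qed

end

type_synonym 'x free_algebra = "'x free_monoid \<Rightarrow>\<^sub>0 complex"

definition gen :: "'x \<Rightarrow> 'x free_algebra" where
  "gen x = Poly_Mapping.single (Word [x]) 1"


section \<open>Tensor products\<close>

definition tensor_relations :: "(('a::complex_vector \<times> 'b::complex_vector) \<Rightarrow>\<^sub>0 complex) set" where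
  "tensor_relations = (let e = (\<lambda>a b. Poly_Mapping.single (a, b) 1) in
     {e (a + a') b - e a b - e a' b | a a' b. True} \<union>
     {e a (b + b') - e a b - e a b' | a b b'. True} \<union>
     {e (c *\<^sub>C a) b - c *\<^sub>C e a b | c a b. True} \<union>
     {e a (c *\<^sub>C b) - c *\<^sub>C e a b | c a b. True})"

definition tensor_cong ::
  "(('a::complex_vector \<times> 'b::complex_vector) \<Rightarrow>\<^sub>0 complex) \<Rightarrow> (('a \<times> 'b) \<Rightarrow>\<^sub>0 complex) \<Rightarrow> bool" where
  "tensor_cong p q \<longleftrightarrow> p - q \<in> complex_vector.span tensor_relations"

lemma tensor_cong_refl: "tensor_cong p p"
  by (simp add: tensor_cong_def complex_vector.span_zero)

lemma tensor_cong_sym: "tensor_cong p q \<Longrightarrow> tensor_cong q p"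
  unfolding tensor_cong_def by (drule complex_vector.span_neg) simp

lemma tensor_cong_trans: "tensor_cong p q \<Longrightarrow> tensor_cong q r \<Longrightarrow> tensor_cong p r"
  unfolding tensor_cong_def by (drule (1) complex_vector.span_add) simp

lemma equivp_tensor_cong: "equivp tensor_cong"
  by (intro equivpI reflpI sympI transpI)
    (blast intro: tensor_cong_refl tensor_cong_sym tensor_cong_trans)+

quotient_type (overloaded) ('a, 'b) tensor =
  "('a::complex_vector \<times> 'b::complex_vector) \<Rightarrow>\<^sub>0 complex" / tensor_cong
  by (rule equivp_tensor_cong)

instantiation tensor :: (complex_vector, complex_vector) complex_vector
begin

lift_definition zero_tensor :: "('a, 'b) tensor" is 0 .

lift_definition plus_tensor :: "('a, 'b) tensor \<Rightarrow> ('a, 'b) tensor \<Rightarrow> ('a, 'b) tensor" is "(+)"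
  unfolding tensor_cong_def by (drule (1) complex_vector.span_add) (simp add: algebra_simps)

lift_definition uminus_tensor :: "('a, 'b) tensor \<Rightarrow> ('a, 'b) tensor" is uminus
  unfolding tensor_cong_def by (drule complex_vector.span_neg) simp

lift_definition minus_tensor :: "('a, 'b) tensor \<Rightarrow> ('a, 'b) tensor \<Rightarrow> ('a, 'b) tensor" is "(-)"
  unfolding tensor_cong_def by (drule (1) complex_vector.span_diff) (simp add: algebra_simps)

lift_definition scaleC_tensor :: "complex \<Rightarrow> ('a, 'b) tensor \<Rightarrow> ('a, 'b) tensor" is scaleC
  unfolding tensor_cong_def
  by (drule complex_vector.span_scale) (simp add: complex_vector.scale_right_diff_distrib)

instance
  by standard
    (transfer; simp add: algebra_simps scaleC_add_right scaleC_add_left scaleC_scaleC scaleC_one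
      tensor_cong_refl)+

end

lift_definition tensor :: "'a::complex_vector \<Rightarrow> 'b::complex_vector \<Rightarrow> ('a, 'b) tensor"
    (infixr \<open>\<otimes>\<close> 70)
  is "\<lambda>a b. Poly_Mapping.single (a, b) 1" .

(* The scalars are absorbed into the first leg. Hence, for biadditive h with
   h (c *\<^sub>C a) b = h a (c *\<^sub>C b), tensor_lift h is the additive map sending a \<otimes> b to h a b,
   whether h is linear or conjugate linear (see tensor_lift_tensor, tensor_lift_add). For other h
   the value depends on the chosen representative and is meaningless. *)
definition tensor_lift_raw ::
  "('a::complex_vector \<Rightarrow> 'b::complex_vector \<Rightarrow> 'c::ab_group_add) \<Rightarrow> (('a \<times> 'b) \<Rightarrow>\<^sub>0 complex) \<Rightarrow> 'c" where
  "tensor_lift_raw h p = (\<Sum>(a, b)\<in>Poly_Mapping.keys p. h (Poly_Mapping.lookup p (a, b) *\<^sub>C a) b)"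

definition tensor_lift ::
  "('a::complex_vector \<Rightarrow> 'b::complex_vector \<Rightarrow> 'c::ab_group_add) \<Rightarrow> ('a, 'b) tensor \<Rightarrow> 'c" where
  "tensor_lift h t = tensor_lift_raw h (rep_tensor t)"

definition balanced :: "('a::complex_vector \<Rightarrow> 'b::complex_vector \<Rightarrow> 'c::ab_group_add) \<Rightarrow> bool" where
  "balanced h \<longleftrightarrow> (\<forall>a a' b. h (a + a') b = h a b + h a' b) \<and>
     (\<forall>a b b'. h a (b + b') = h a b + h a b') \<and> (\<forall>c a b. h (c *\<^sub>C a) b = h a (c *\<^sub>C b))"

lemma balanced_0:
  assumes "balanced h"
  shows "h 0 b = 0" "h a 0 = 0"
proof -
  have "h (0 + 0) b = h 0 b + h 0 b" "h a (0 + 0) = h a 0 + h a 0"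
    using assms unfolding balanced_def by blast+
  then show "h 0 b = 0" "h a 0 = 0" by simp_all
qed

lemma tensor_lift_raw_superset:
  assumes "balanced h" "finite K" "Poly_Mapping.keys p \<subseteq> K"
  shows "tensor_lift_raw h p = (\<Sum>(a, b)\<in>K. h (Poly_Mapping.lookup p (a, b) *\<^sub>C a) b)"
  unfolding tensor_lift_raw_def
  using assms by (intro sum.mono_neutral_left) (auto simp: in_keys_iff balanced_0)

lemma tensor_lift_raw_add:
  assumes "balanced h"
  shows "tensor_lift_raw h (p + q) = tensor_lift_raw h p + tensor_lift_raw h q"
proof -
  let ?K = "Poly_Mapping.keys p \<union> Poly_Mapping.keys q"
  have "tensor_lift_raw h (p + q) = (\<Sum>(a, b)\<in>?K. h (Poly_Mapping.lookup (p + q) (a, b) *\<^sub>C a) b)"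
    using assms Poly_Mapping.keys_add[of p q] by (intro tensor_lift_raw_superset) auto
  also have "\<dots> = (\<Sum>(a, b)\<in>?K. h (Poly_Mapping.lookup p (a, b) *\<^sub>C a) b) + (\<Sum>(a, b)\<in>?K. h (Poly_Mapping.lookup q (a, b) *\<^sub>C a) b)"
    using assms
    by (simp add: lookup_add scaleC_add_left balanced_def case_prod_unfold sum.distrib)
  also have "\<dots> = tensor_lift_raw h p + tensor_lift_raw h q"
    using assms by (simp add: tensor_lift_raw_superset[of h ?K])
  finally show ?thesis .
qed

lemma tensor_lift_raw_single:
  assumes "balanced h"
  shows "tensor_lift_raw h (Poly_Mapping.single (a, b) c) = h (c *\<^sub>C a) b"
  using assms by (simp add: tensor_lift_raw_def balanced_0)

lemma tensor_lift_raw_0: "tensor_lift_raw h 0 = 0"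
  by (simp add: tensor_lift_raw_def)

lemma tensor_lift_raw_diff:
  assumes "balanced h"
  shows "tensor_lift_raw h (p - q) = tensor_lift_raw h p - tensor_lift_raw h q"
  using tensor_lift_raw_add[OF assms, of "p - q" q] by simp

lemma tensor_lift_raw_cong:
  assumes h: "balanced h" and "tensor_cong p q"
  shows "tensor_lift_raw h p = tensor_lift_raw h q"
proof -
  have "p - q \<in> complex_vector.span tensor_relations"
    using assms by (simp add: tensor_cong_def)
  then have "\<forall>d. tensor_lift_raw h (d *\<^sub>C (p - q)) = 0"
  proof (induction rule: complex_vector.span_induct)
    case base
    show ?case
      unfolding complex_vector.subspace_def mem_Collect_eq
      by (simp add: tensor_lift_raw_0 scaleC_add_right tensor_lift_raw_add[OF h] scaleC_scaleC)
  next
    case (step r)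
    have hr: "h (a + a') b = h a b + h a' b" "h a (b + b') = h a b + h a b'"
      "h a (c *\<^sub>C b) = h (c *\<^sub>C a) b" for a a' b b' c
      using h unfolding balanced_def by auto
    from step show ?case
      unfolding tensor_relations_def Let_def
      by (auto simp: complex_vector.scale_right_diff_distrib scaleC_single
          tensor_lift_raw_diff[OF h] tensor_lift_raw_single[OF h] hr scaleC_add_right scaleC_scaleC
          scaleC_complex_def mult.commute)
  qed
  from spec[OF this, of 1] show ?thesis
    by (simp add: tensor_lift_raw_diff[OF h] scaleC_one)
qed

lemma tensor_lift_abs:
  assumes "balanced h"
  shows "tensor_lift h (abs_tensor p) = tensor_lift_raw h p"
  unfolding tensor_lift_def
  by (intro tensor_lift_raw_cong[OF assms]) (simp add: Quotient3_rep_abs[OF Quotient3_tensor] tensor_cong_refl)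

lemma tensor_lift_tensor: "balanced h \<Longrightarrow> tensor_lift h (a \<otimes> b) = h a b"
  by (simp add: tensor.abs_eq tensor_lift_abs tensor_lift_raw_single scaleC_one)

lemma tensor_lift_add:
  assumes "balanced h"
  shows "tensor_lift h (s + t) = tensor_lift h s + tensor_lift h t"
  by (induction s rule: tensor.abs_induct, induction t rule: tensor.abs_induct)
    (simp add: plus_tensor.abs_eq tensor_lift_abs[OF assms] tensor_lift_raw_add[OF assms])

lemma tensor_add_left: "(a + a') \<otimes> b = a \<otimes> b + a' \<otimes> b"
proof transfer
  fix a a' :: 'a and b :: 'b
  let ?e = "\<lambda>a b. Poly_Mapping.single (a, b) (1::complex)"
  have "?e (a + a') b - ?e a b - ?e a' b \<in> tensor_relations"
    unfolding tensor_relations_def Let_def by blast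
  then show "tensor_cong (?e (a + a') b) (?e a b + ?e a' b)"
    unfolding tensor_cong_def diff_diff_add[symmetric] by (rule complex_vector.span_base)
qed

lemma tensor_add_right: "a \<otimes> (b + b') = a \<otimes> b + a \<otimes> b'"
proof transfer
  fix a :: 'a and b b' :: 'b
  let ?e = "\<lambda>a b. Poly_Mapping.single (a, b) (1::complex)"
  have "?e a (b + b') - ?e a b - ?e a b' \<in> tensor_relations"
    unfolding tensor_relations_def Let_def by blast
  then show "tensor_cong (?e a (b + b')) (?e a b + ?e a b')"
    unfolding tensor_cong_def diff_diff_add[symmetric] by (rule complex_vector.span_base)
qed

lemma tensor_scaleC_left: "(c *\<^sub>C a) \<otimes> b = c *\<^sub>C (a \<otimes> b)"
proof transfer
  fix c and a :: 'a and b :: 'b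
  let ?e = "\<lambda>a b. Poly_Mapping.single (a, b) (1::complex)"
  have "?e (c *\<^sub>C a) b - c *\<^sub>C ?e a b \<in> tensor_relations"
    unfolding tensor_relations_def Let_def by blast
  then show "tensor_cong (?e (c *\<^sub>C a) b) (c *\<^sub>C ?e a b)"
    unfolding tensor_cong_def by (rule complex_vector.span_base)
qed

lemma tensor_scaleC_right: "a \<otimes> (c *\<^sub>C b) = c *\<^sub>C (a \<otimes> b)"
proof transfer
  fix c and a :: 'a and b :: 'b
  let ?e = "\<lambda>a b. Poly_Mapping.single (a, b) (1::complex)"
  have "?e a (c *\<^sub>C b) - c *\<^sub>C ?e a b \<in> tensor_relations"
    unfolding tensor_relations_def Let_def by blast
  then show "tensor_cong (?e a (c *\<^sub>C b)) (c *\<^sub>C ?e a b)"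
    unfolding tensor_cong_def by (rule complex_vector.span_base)
qed

lemma tensor_induct [case_names zero tensor add]:
  assumes "P 0" "\<And>a b. P (a \<otimes> b)" "\<And>s t. P s \<Longrightarrow> P t \<Longrightarrow> P (s + t)"
  shows "P t"
proof (induction t rule: tensor.abs_induct)
  case (1 p)
  show ?case
  proof (induction p rule: poly_mapping_scaleC_induct)
    case zero
    show ?case using assms(1) by (simp add: zero_tensor.abs_eq)
  next
    case (single k c)
    obtain a b where k: "k = (a, b)" by force
    have "abs_tensor (Poly_Mapping.single k c) = (c *\<^sub>C a) \<otimes> b"
      unfolding tensor_scaleC_left k
      by (simp add: tensor.abs_eq scaleC_tensor.abs_eq scaleC_single scaleC_complex_def)
    then show ?case using assms(2) by simp
  next
    case (add p q)
    then show ?case using assms(3) by (simp add: plus_tensor.abs_eq[symmetric])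
  qed
qed

definition tensor_map ::
  "('a::complex_vector \<Rightarrow> 'c::complex_vector) \<Rightarrow> ('b::complex_vector \<Rightarrow> 'd::complex_vector) \<Rightarrow>
     ('a, 'b) tensor \<Rightarrow> ('c, 'd) tensor" where
  "tensor_map f g = tensor_lift (\<lambda>a b. f a \<otimes> g b)"

definition tensor_assoc ::
  "(('a::complex_vector, 'b::complex_vector) tensor, 'c::complex_vector) tensor \<Rightarrow>
     ('a, ('b, 'c) tensor) tensor" where
  "tensor_assoc = tensor_lift (\<lambda>t c. tensor_lift (\<lambda>a b. a \<otimes> b \<otimes> c) t)"

instantiation tensor :: (complex_unital_algebra, complex_unital_algebra) complex_unital_algebra
begin

definition one_tensor :: "('a, 'b) tensor" where
  "one_tensor = 1 \<otimes> 1"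

definition times_tensor :: "('a, 'b) tensor \<Rightarrow> ('a, 'b) tensor \<Rightarrow> ('a, 'b) tensor" where
  "times_tensor s t = tensor_lift (\<lambda>a b. tensor_lift (\<lambda>a' b'. (a * a') \<otimes> (b * b')) t) s"

lemma balanced_times_inner: "balanced (\<lambda>a' b'. ((a::'a) * a') \<otimes> ((b::'b) * b'))"
  by (simp add: balanced_def distrib_left tensor_add_left tensor_add_right mult_scaleC_right
      tensor_scaleC_left tensor_scaleC_right)

lemma balanced_times_outer:
  "balanced (\<lambda>a b. tensor_lift (\<lambda>a' b'. ((a::'a) * a') \<otimes> ((b::'b) * b')) t)"
proof (induction t rule: tensor_induct)
  case zero
  have "tensor_lift (\<lambda>a' b'. (a * a') \<otimes> (b * b')) 0 = 0" for a :: 'a and b :: 'b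
    using tensor_lift_add[OF balanced_times_inner, of a b 0 0] by simp
  then show ?case by (simp add: balanced_def)
next
  case (tensor c d)
  show ?case
    by (simp add: tensor_lift_tensor[OF balanced_times_inner] balanced_def distrib_right
        tensor_add_left tensor_add_right mult_scaleC_left tensor_scaleC_left tensor_scaleC_right)
next
  case (add s t)
  then show ?case
    unfolding tensor_lift_add[OF balanced_times_inner] balanced_def by simp
qed

lemma tensor_times:
  "(a \<otimes> b) * t = tensor_lift (\<lambda>a' b'. ((a::'a) * a') \<otimes> ((b::'b) * b')) t"
  by (simp add: times_tensor_def tensor_lift_tensor[OF balanced_times_outer])

lemma tensor_mult_tensor: "(a \<otimes> b) * (a' \<otimes> b') = ((a::'a) * a') \<otimes> ((b::'b) * b')"
  by (simp add: tensor_times tensor_lift_tensor[OF balanced_times_inner])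

lemma times_tensor_add:
  fixes r s t :: "('a, 'b) tensor"
  shows "(r + s) * t = r * t + s * t" "r * (s + t) = r * s + r * t"
proof -
  show l: "(r + s) * t = r * t + s * t" for r s t :: "('a, 'b) tensor"
    by (simp add: times_tensor_def tensor_lift_add[OF balanced_times_outer])
  have z: "0 * t = 0" for t :: "('a, 'b) tensor"
    using l[of 0 0 t] by simp
  show "r * (s + t) = r * s + r * t"
  proof (induction r rule: tensor_induct)
    case (tensor a b)
    show ?case
      by (simp add: tensor_times tensor_lift_add[OF balanced_times_inner])
  qed (simp_all add: l z)
qed

lemma times_tensor_0:
  fixes t :: "('a, 'b) tensor"
  shows "0 * t = 0" "t * 0 = 0"
  using times_tensor_add(1)[of 0 0 t] times_tensor_add(2)[of t 0 0] by simp_all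

instance
proof
  fix a b c :: "('a, 'b) tensor" and z :: complex
  show "(a + b) * c = a * c + b * c" "a * (b + c) = a * b + a * c"
    by (rule times_tensor_add)+
  show "1 * a = a" "a * 1 = a"
    by (induction a rule: tensor_induct;
        simp add: one_tensor_def tensor_mult_tensor times_tensor_add times_tensor_0)+
  show "(z *\<^sub>C a) * b = z *\<^sub>C (a * b)"
  proof (induction a rule: tensor_induct)
    case (tensor x y)
    show ?case
      by (induction b rule: tensor_induct)
        (simp_all add: tensor_scaleC_left[symmetric] tensor_mult_tensor times_tensor_add
          times_tensor_0 mult_scaleC_left scaleC_add_right)
  qed (simp_all add: times_tensor_add times_tensor_0 scaleC_add_right)
  show "a * (z *\<^sub>C b) = z *\<^sub>C (a * b)"
  proof (induction a rule: tensor_induct)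
    case (tensor x y)
    show ?case
      by (induction b rule: tensor_induct)
        (simp_all add: tensor_scaleC_left[symmetric] tensor_mult_tensor times_tensor_add
          times_tensor_0 mult_scaleC_right scaleC_add_right)
  qed (simp_all add: times_tensor_add times_tensor_0 scaleC_add_right)
  show "a * b * c = a * (b * c)"
  proof (induction a rule: tensor_induct)
    case (tensor x y)
    show ?case
    proof (induction b rule: tensor_induct)
      case (tensor x' y')
      show ?case
        by (induction c rule: tensor_induct)
          (simp_all add: tensor_mult_tensor times_tensor_add times_tensor_0 mult.assoc)
    qed (simp_all add: times_tensor_add times_tensor_0)
  qed (simp_all add: times_tensor_add times_tensor_0)
qed

end


section \<open>Hopf algebras, Hopf *-algebras and CQG algebras\<close>

locale hopf_algebra =
  fixes comult :: "'a::complex_unital_algebra \<Rightarrow> ('a, 'a) tensor"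
    and counit :: "'a \<Rightarrow> complex"
    and antipode :: "'a \<Rightarrow> 'a"
  assumes comult_hom: "algebra_hom comult"
    and counit_hom: "algebra_hom counit"
    and coassoc: "tensor_assoc (tensor_map comult id (comult a)) = tensor_map id comult (comult a)"
    and counit_left: "tensor_lift (\<lambda>b c. counit b *\<^sub>C c) (comult a) = a"
    and counit_right: "tensor_lift (\<lambda>b c. counit c *\<^sub>C b) (comult a) = a"
    and antipode_linear: "clinear antipode"
    and antipode_left: "tensor_lift (\<lambda>b c. antipode b * c) (comult a) = counit a *\<^sub>C 1"
    and antipode_right: "tensor_lift (\<lambda>b c. b * antipode c) (comult a) = counit a *\<^sub>C 1"

(* The involution of the tensor square is star \<otimes> star; compatibility of the counit and the
   antipode with star follows from that of the comultiplication. *)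
locale hopf_star_algebra = hopf_algebra comult counit antipode
  for comult :: "'a::complex_unital_algebra \<Rightarrow> ('a, 'a) tensor"
    and counit :: "'a \<Rightarrow> complex"
    and antipode :: "'a \<Rightarrow> 'a" +
  fixes star :: "'a \<Rightarrow> 'a"
  assumes star_add: "star (a + b) = star a + star b"
    and star_scaleC: "star (c *\<^sub>C a) = cnj c *\<^sub>C star a"
    and star_mult: "star (a * b) = star b * star a"
    and star_star: "star (star a) = a"
    and comult_star: "comult (star a) = tensor_map star star (comult a)"

(* A d x d matrix is a function of two indices, of which only the values at indices < d matter. *)
definition matrix_corepresentation ::
  "('a::complex_unital_algebra \<Rightarrow> ('a, 'a) tensor) \<Rightarrow> ('a \<Rightarrow> complex) \<Rightarrow>
     nat \<Rightarrow> (nat \<Rightarrow> nat \<Rightarrow> 'a) \<Rightarrow> bool" where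
  "matrix_corepresentation comult counit d u \<longleftrightarrow>
     (\<forall>k<d. \<forall>l<d. comult (u k l) = (\<Sum>s<d. u k s \<otimes> u s l) \<and>
       counit (u k l) = (if k = l then 1 else 0))"

definition unitary_matrix ::
  "('a::complex_unital_algebra \<Rightarrow> 'a) \<Rightarrow> nat \<Rightarrow> (nat \<Rightarrow> nat \<Rightarrow> 'a) \<Rightarrow> bool" where
  "unitary_matrix star d u \<longleftrightarrow>
     (\<forall>k<d. \<forall>l<d. (\<Sum>s<d. u k s * star (u l s)) = (if k = l then 1 else 0) \<and>
       (\<Sum>s<d. star (u s k) * u s l) = (if k = l then 1 else 0))"

locale cqg_algebra = hopf_star_algebra +
  assumes generated_by_coefficients:
    "\<exists>F. (\<forall>(d, u)\<in>F. matrix_corepresentation comult counit d u \<and> unitary_matrix star d u) \<and>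
       unital_subalgebra hull {u k l | d u k l. (d, u) \<in> F \<and> k < d \<and> l < d} = UNIV"


section \<open>Free products, the quantum permutation algebra and the free wreath product\<close>

(* The relations making j an algebra homomorphism. *)
definition hom_relations ::
  "('a::complex_unital_algebra \<Rightarrow> 'f::complex_unital_algebra) \<Rightarrow> 'f set" where
  "hom_relations j =
     {j (a + b) - (j a + j b) | a b. True} \<union>
     {j (c *\<^sub>C a) - c *\<^sub>C j a | c a. True} \<union>
     {j (a * b) - j a * j b | a b. True} \<union>
     {j 1 - 1}"

(* The free product of a family of copies of 'a indexed by the type 'n. *)
definition free_power_relations :: "('n \<times> 'a::complex_unital_algebra) free_algebra set" where
  "free_power_relations = (\<Union>i. hom_relations (\<lambda>a. gen (i, a)))"

quotient_type (overloaded) ('a, 'n) free_power =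
  "('n \<times> 'a::complex_unital_algebra) free_algebra" / "ideal_cong free_power_relations"
  by (rule equivp_ideal_cong)

instantiation free_power :: (complex_unital_algebra, type) complex_unital_algebra
begin

lift_definition zero_free_power :: "('a, 'b) free_power" is 0 .
lift_definition one_free_power :: "('a, 'b) free_power" is 1 .
lift_definition plus_free_power :: "('a, 'b) free_power \<Rightarrow> ('a, 'b) free_power \<Rightarrow> ('a, 'b) free_power" is "(+)"
  by (rule ideal_cong_add)
lift_definition uminus_free_power :: "('a, 'b) free_power \<Rightarrow> ('a, 'b) free_power" is uminus
  by (rule ideal_cong_uminus)
lift_definition minus_free_power :: "('a, 'b) free_power \<Rightarrow> ('a, 'b) free_power \<Rightarrow> ('a, 'b) free_power" is "(-)"
  by (rule ideal_cong_diff)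
lift_definition times_free_power :: "('a, 'b) free_power \<Rightarrow> ('a, 'b) free_power \<Rightarrow> ('a, 'b) free_power" is "(*)"
  by (rule ideal_cong_mult)
lift_definition scaleC_free_power :: "complex \<Rightarrow> ('a, 'b) free_power \<Rightarrow> ('a, 'b) free_power" is scaleC
  by (rule ideal_cong_scaleC)

instance
  by standard
    (transfer; simp add: algebra_simps mult.assoc scaleC_add_right scaleC_add_left scaleC_scaleC
      scaleC_one mult_scaleC_left mult_scaleC_right ideal_cong_refl)+

end

lift_definition free_power_embed :: "'n \<Rightarrow> 'a::complex_unital_algebra \<Rightarrow> ('a, 'n) free_power"
  is "\<lambda>i a. gen (i, a)" .

definition free_product_relations ::
  "('a::complex_unital_algebra + 'b::complex_unital_algebra) free_algebra set" where
  "free_product_relations =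
     hom_relations (\<lambda>a. gen (Inl a)) \<union> hom_relations (\<lambda>b. gen (Inr b))"

quotient_type (overloaded) ('a, 'b) free_product =
  "('a::complex_unital_algebra + 'b::complex_unital_algebra) free_algebra" /
  "ideal_cong free_product_relations"
  by (rule equivp_ideal_cong)

instantiation free_product :: (complex_unital_algebra, complex_unital_algebra) complex_unital_algebra
begin

lift_definition zero_free_product :: "('a, 'b) free_product" is 0 .
lift_definition one_free_product :: "('a, 'b) free_product" is 1 .
lift_definition plus_free_product :: "('a, 'b) free_product \<Rightarrow> ('a, 'b) free_product \<Rightarrow> ('a, 'b) free_product" is "(+)"
  by (rule ideal_cong_add)
lift_definition uminus_free_product :: "('a, 'b) free_product \<Rightarrow> ('a, 'b) free_product" is uminus
  by (rule ideal_cong_uminus)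
lift_definition minus_free_product :: "('a, 'b) free_product \<Rightarrow> ('a, 'b) free_product \<Rightarrow> ('a, 'b) free_product" is "(-)"
  by (rule ideal_cong_diff)
lift_definition times_free_product :: "('a, 'b) free_product \<Rightarrow> ('a, 'b) free_product \<Rightarrow> ('a, 'b) free_product" is "(*)"
  by (rule ideal_cong_mult)
lift_definition scaleC_free_product :: "complex \<Rightarrow> ('a, 'b) free_product \<Rightarrow> ('a, 'b) free_product" is scaleC
  by (rule ideal_cong_scaleC)

instance
  by standard
    (transfer; simp add: algebra_simps mult.assoc scaleC_add_right scaleC_add_left scaleC_scaleC
      scaleC_one mult_scaleC_left mult_scaleC_right ideal_cong_refl)+

end

lift_definition free_product_inl ::
  "'a::complex_unital_algebra \<Rightarrow> ('a, 'b::complex_unital_algebra) free_product"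
  is "\<lambda>a. gen (Inl a)" .

lift_definition free_product_inr ::
  "'b::complex_unital_algebra \<Rightarrow> ('a::complex_unital_algebra, 'b) free_product"
  is "\<lambda>b. gen (Inr b)" .

definition quantum_perm_relations :: "('n::finite \<times> 'n) free_algebra set" where
  "quantum_perm_relations = (let x = (\<lambda>i j. gen (i, j)) in
     {x i j * x i k - (if j = k then x i j else 0) | i j k. True} \<union>
     {x j i * x k i - (if j = k then x j i else 0) | i j k. True} \<union>
     {(\<Sum>l\<in>UNIV. x i l) - 1 | i. True} \<union>
     {(\<Sum>l\<in>UNIV. x l i) - 1 | i. True})"

quotient_type (overloaded) 'n quantum_perm =
  "('n::finite \<times> 'n) free_algebra" / "ideal_cong quantum_perm_relations"
  by (rule equivp_ideal_cong)

instantiation quantum_perm :: (finite) complex_unital_algebra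
begin

lift_definition zero_quantum_perm :: "'a quantum_perm" is 0 .
lift_definition one_quantum_perm :: "'a quantum_perm" is 1 .
lift_definition plus_quantum_perm :: "'a quantum_perm \<Rightarrow> 'a quantum_perm \<Rightarrow> 'a quantum_perm" is "(+)"
  by (rule ideal_cong_add)
lift_definition uminus_quantum_perm :: "'a quantum_perm \<Rightarrow> 'a quantum_perm" is uminus
  by (rule ideal_cong_uminus)
lift_definition minus_quantum_perm :: "'a quantum_perm \<Rightarrow> 'a quantum_perm \<Rightarrow> 'a quantum_perm" is "(-)"
  by (rule ideal_cong_diff)
lift_definition times_quantum_perm :: "'a quantum_perm \<Rightarrow> 'a quantum_perm \<Rightarrow> 'a quantum_perm" is "(*)"
  by (rule ideal_cong_mult)
lift_definition scaleC_quantum_perm :: "complex \<Rightarrow> 'a quantum_perm \<Rightarrow> 'a quantum_perm" is scaleC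
  by (rule ideal_cong_scaleC)

instance
  by standard
    (transfer; simp add: algebra_simps mult.assoc scaleC_add_right scaleC_add_left scaleC_scaleC
      scaleC_one mult_scaleC_left mult_scaleC_right ideal_cong_refl)+

end

lift_definition quantum_perm_gen :: "'n::finite \<Rightarrow> 'n \<Rightarrow> 'n quantum_perm"
  is "\<lambda>i j. gen (i, j)" .

definition free_wreath_relations ::
  "(('a::complex_unital_algebra, 'n::finite) free_power, 'n quantum_perm) free_product set" where
  "free_wreath_relations =
     (let nu = (\<lambda>k a. free_product_inl (free_power_embed k a));
          x = (\<lambda>k i. free_product_inr (quantum_perm_gen k i))
      in {nu k a * x k i - x k i * nu k a | i k a. True})"

quotient_type (overloaded) ('a, 'n) free_wreath =
  "(('a::complex_unital_algebra, 'n::finite) free_power, 'n quantum_perm) free_product" /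
  "ideal_cong free_wreath_relations"
  by (rule equivp_ideal_cong)

instantiation free_wreath :: (complex_unital_algebra, finite) complex_unital_algebra
begin

lift_definition zero_free_wreath :: "('a, 'b) free_wreath" is 0 .
lift_definition one_free_wreath :: "('a, 'b) free_wreath" is 1 .
lift_definition plus_free_wreath :: "('a, 'b) free_wreath \<Rightarrow> ('a, 'b) free_wreath \<Rightarrow> ('a, 'b) free_wreath" is "(+)"
  by (rule ideal_cong_add)
lift_definition uminus_free_wreath :: "('a, 'b) free_wreath \<Rightarrow> ('a, 'b) free_wreath" is uminus
  by (rule ideal_cong_uminus)
lift_definition minus_free_wreath :: "('a, 'b) free_wreath \<Rightarrow> ('a, 'b) free_wreath \<Rightarrow> ('a, 'b) free_wreath" is "(-)"
  by (rule ideal_cong_diff)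
lift_definition times_free_wreath :: "('a, 'b) free_wreath \<Rightarrow> ('a, 'b) free_wreath \<Rightarrow> ('a, 'b) free_wreath" is "(*)"
  by (rule ideal_cong_mult)
lift_definition scaleC_free_wreath :: "complex \<Rightarrow> ('a, 'b) free_wreath \<Rightarrow> ('a, 'b) free_wreath" is scaleC
  by (rule ideal_cong_scaleC)

instance
  by standard
    (transfer; simp add: algebra_simps mult.assoc scaleC_add_right scaleC_add_left scaleC_scaleC
      scaleC_one mult_scaleC_left mult_scaleC_right ideal_cong_refl)+

end

lift_definition wreath_nu ::
  "'n::finite \<Rightarrow> 'a::complex_unital_algebra \<Rightarrow> ('a, 'n) free_wreath"
  is "\<lambda>i a. free_product_inl (free_power_embed i a)" .

lift_definition wreath_x ::
  "'n::finite \<Rightarrow> 'n \<Rightarrow> ('a::complex_unital_algebra, 'n) free_wreath"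
  is "\<lambda>i j. free_product_inr (quantum_perm_gen i j)" .

end

theory Submission
  imports Defs
begin

text \<open>The universal property of the free wreath product yields the comultiplication and the counit as
  homomorphisms, the antipode as a homomorphism to the opposite algebra, and the involution as a
  homomorphism to the conjugate of the opposite algebra. For the comultiplication
  and the antipode, the images of the \<open>\<nu>\<^sub>i a\<close> are multiplicative in \<open>a\<close> for the same reason:
  \<open>\<Sum>\<^sub>k T\<^sub>k(a) p\<^sub>k\<close> is a homomorphism if the
  \<open>T\<^sub>k\<close> are homomorphisms and the \<open>p\<^sub>k\<close> are orthogonal idempotents with sum \<open>1\<close> such that \<open>p\<^sub>k\<close>
  commutes with the range of \<open>T\<^sub>k\<close>. The Hopf algebra axioms then only need to be checked on the
  generators. A unitary corepresentation \<open>u\<close> of the base algebra gives the unitary corepresentation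
  with coefficients \<open>\<nu>\<^sub>i(u\<^sub>p\<^sub>q) x\<^sub>i\<^sub>j\<close>, and summing these over \<open>j\<close> recovers \<open>\<nu>\<^sub>i(u\<^sub>p\<^sub>q)\<close>.\<close>

section \<open>Linear maps and algebra homomorphisms\<close>

text \<open>A Hopf algebra is given here with an antipode that is merely linear. Mapping the wreath
  product to its opposite algebra requires a base antipode that reverses products, so this is
  derived first, from the fact that the antipode inverts the identity under convolution.

  Coassociativity and the counit laws compare homomorphisms and are settled on generators. The
  antipode laws are not of this kind: convolving the antipode with the identity does not give a
  homomorphism. They pass from generators to products because the antipode reverses products and the
  inner convolution collapses to a scalar.

  Sweedler sums are handled by linearity: an identity in \<open>comult a\<close> is stated with an
  arbitrary tensor in place of \<open>comult a\<close> and checked on pure tensors; the axioms of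
  the base algebra enter only afterwards.

  In the criterion for sums with idempotents, the comultiplication takes its idempotents from a row
  of the matrix of the \<open>wreath_x i j\<close>, the antipode from a column.\<close>

lemma clinear_iff:
  "clinear f \<longleftrightarrow> (\<forall>x y. f (x + y) = f x + f y) \<and> (\<forall>c x. f (c *\<^sub>C x) = c *\<^sub>C f x)"
  by (simp add: Vector_Spaces.linear_iff complex_vector.vector_space_axioms)

lemma clinear_0: "clinear f \<Longrightarrow> f 0 = 0"
  unfolding clinear_iff by (metis add_cancel_right_right)

lemma clinear_sum: "clinear f \<Longrightarrow> f (sum g I) = (\<Sum>i\<in>I. f (g i))"
  by (induction I rule: infinite_finite_induct) (simp_all add: clinear_0 clinear_iff)

lemma algebra_hom_clinear: "algebra_hom f \<Longrightarrow> clinear f"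
  by (simp add: algebra_hom_def)

lemma algebra_hom_simps:
  assumes "algebra_hom f"
  shows "f (x + y) = f x + f y" "f (c *\<^sub>C x) = c *\<^sub>C f x" "f 0 = 0" "f 1 = 1"
    "f (x * y) = f x * f y" "f (x - y) = f x - f y" "f (sum g I) = (\<Sum>i\<in>I. f (g i))"
proof -
  have lin: "clinear f"
    using assms by (rule algebra_hom_clinear)
  then show add: "f (x + y) = f x + f y" "f (c *\<^sub>C x) = c *\<^sub>C f x" for x y
    by (simp_all add: clinear_iff)
  show "f 0 = 0" "f (sum g I) = (\<Sum>i\<in>I. f (g i))"
    using lin by (simp_all add: clinear_0 clinear_sum)
  show "f 1 = 1" "f (x * y) = f x * f y"
    using assms by (simp_all add: algebra_hom_def)
  show "f (x - y) = f x - f y"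
    using add(1)[of "x - y" y] by (simp add: algebra_simps)
qed

lemma algebra_homI:
  assumes "\<And>x y. f (x + y) = f x + f y" "\<And>c x. f (c *\<^sub>C x) = c *\<^sub>C f x"
    "f 1 = 1" "\<And>x y. f (x * y) = f x * f y"
  shows "algebra_hom f"
  using assms by (simp add: algebra_hom_def clinear_iff)

lemma algebra_hom_id: "algebra_hom id"
  by (rule algebra_homI) simp_all

lemma algebra_hom_comp:
  assumes "algebra_hom f" "algebra_hom g"
  shows "algebra_hom (\<lambda>x. f (g x))"
  by (rule algebra_homI)
    (simp_all add: algebra_hom_simps[OF assms(1)] algebra_hom_simps[OF assms(2)])

lemma algebra_hom_sum_idempotents:
  fixes T :: "'n::finite \<Rightarrow> 'a::complex_unital_algebra \<Rightarrow> 'b::complex_unital_algebra"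
  assumes T: "\<And>k. algebra_hom (T k)"
    and p: "\<And>k l. p k * p l = (if k = l then p k else 0)" "(\<Sum>k\<in>UNIV. p k) = 1"
    and comm: "\<And>k a. T k a * p k = p k * T k a"
  shows "algebra_hom (\<lambda>a. \<Sum>k\<in>UNIV. T k a * p k)"
proof (rule algebra_homI)
  fix a b
  have "T k a * p k * (T l b * p l) = (if k = l then T k (a * b) * p k else 0)" for k l
  proof -
    \<comment> \<open>Moving \<open>p l\<close> to the left of \<open>T l b\<close> brings the two
      idempotents together, so only the terms with \<open>k = l\<close> survive.\<close>
    have "T k a * p k * (T l b * p l) = T k a * (p k * p l) * T l b"
      unfolding comm[of l b] by (simp add: mult.assoc)
    also have "\<dots> = (if k = l then T k a * p k * T k b else 0)"
      by (simp add: p(1))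
    also have "T k a * p k * T k b = T k (a * b) * p k"
      by (simp only: algebra_hom_simps(5)[OF T] mult.assoc comm[of k b, symmetric])
    finally show ?thesis .
  qed
  then show "(\<Sum>k\<in>UNIV. T k (a * b) * p k) =
      (\<Sum>k\<in>UNIV. T k a * p k) * (\<Sum>k\<in>UNIV. T k b * p k)"
    by (simp add: sum_distrib_left sum_distrib_right)
qed (simp_all add: algebra_hom_simps[OF T] p distrib_right sum.distrib mult_scaleC_left
    complex_vector.scale_sum_right)

section \<open>Universal properties\<close>

fun word_prod :: "('x \<Rightarrow> 'b::monoid_mult) \<Rightarrow> 'x free_monoid \<Rightarrow> 'b" where
  "word_prod \<phi> (Word w) = prod_list (map \<phi> w)"

lemma word_prod_plus: "word_prod \<phi> (v + w) = word_prod \<phi> v * word_prod \<phi> w"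
  by (cases v; cases w) simp

definition free_lift :: "('x \<Rightarrow> 'b::complex_unital_algebra) \<Rightarrow> 'x free_algebra \<Rightarrow> 'b" where
  "free_lift \<phi> p = (\<Sum>w\<in>Poly_Mapping.keys p. Poly_Mapping.lookup p w *\<^sub>C word_prod \<phi> w)"

lemma free_lift_superset:
  assumes "finite K" "Poly_Mapping.keys p \<subseteq> K"
  shows "free_lift \<phi> p = (\<Sum>w\<in>K. Poly_Mapping.lookup p w *\<^sub>C word_prod \<phi> w)"
  unfolding free_lift_def
  using assms by (intro sum.mono_neutral_left) (auto simp: in_keys_iff)

lemma free_lift_add: "free_lift \<phi> (p + q) = free_lift \<phi> p + free_lift \<phi> q"
proof -
  let ?K = "Poly_Mapping.keys p \<union> Poly_Mapping.keys q"
  have "free_lift \<phi> r = (\<Sum>w\<in>?K. Poly_Mapping.lookup r w *\<^sub>C word_prod \<phi> w)"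
    if "r \<in> {p, q, p + q}" for r
    using that Poly_Mapping.keys_add[of p q] by (intro free_lift_superset) auto
  then show ?thesis
    by (simp add: lookup_add scaleC_add_left sum.distrib)
qed

lemma free_lift_single: "free_lift \<phi> (Poly_Mapping.single w c) = c *\<^sub>C word_prod \<phi> w"
  by (simp add: free_lift_def)

lemma free_lift_0: "free_lift \<phi> 0 = 0"
  by (simp add: free_lift_def)

lemma free_lift_gen: "free_lift \<phi> (gen x) = \<phi> x"
  by (simp add: gen_def free_lift_single scaleC_one)

lemma algebra_hom_free_lift: "algebra_hom (free_lift \<phi>)"
proof (rule algebra_homI)
  fix p q :: "'a free_algebra" and c
  show "free_lift \<phi> (p + q) = free_lift \<phi> p + free_lift \<phi> q"
    by (rule free_lift_add)
  show "free_lift \<phi> (c *\<^sub>C p) = c *\<^sub>C free_lift \<phi> p"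
    by (induction p rule: poly_mapping_scaleC_induct)
      (simp_all add: free_lift_0 free_lift_add free_lift_single scaleC_single scaleC_scaleC
        scaleC_complex_def scaleC_add_right)
  show "free_lift \<phi> (p * q) = free_lift \<phi> p * free_lift \<phi> q"
  proof (induction p rule: poly_mapping_scaleC_induct)
    case (single v a)
    show ?case
      by (induction q rule: poly_mapping_scaleC_induct)
        (simp_all add: free_lift_0 free_lift_add free_lift_single mult_single word_prod_plus
          distrib_left mult_scaleC_left mult_scaleC_right scaleC_scaleC)
  qed (simp_all add: free_lift_0 free_lift_add distrib_right)
  show "free_lift \<phi> 1 = 1"
    by (simp add: single_one[symmetric] free_lift_single zero_free_monoid_def scaleC_one
        del: single_one)
qed

text \<open>Scaling has no case of its own because \<open>c *\<^sub>C p\<close> is the product of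
  \<open>c *\<^sub>C 1\<close> and \<open>p\<close>.\<close>

lemma free_algebra_induct [case_names scalar gen add mult]:
  assumes scalar: "\<And>c. P (c *\<^sub>C 1)" and gen: "\<And>x. P (gen x)"
    and add: "\<And>p q. P p \<Longrightarrow> P q \<Longrightarrow> P (p + q)" and mult: "\<And>p q. P p \<Longrightarrow> P q \<Longrightarrow> P (p * q)"
  shows "P (p :: 'x free_algebra)"
proof (induction p rule: poly_mapping_scaleC_induct)
  case zero
  show ?case using scalar[of 0] by simp
next
  case (single w c)
  have one: "(1 :: 'x free_algebra) = Poly_Mapping.single (Word []) 1"
    by (simp add: single_one[symmetric] zero_free_monoid_def del: single_one)
  have "P (Poly_Mapping.single (Word xs) 1)" for xs :: "'x list"
  proof (induction xs)
    case Nil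
    show ?case using scalar[of 1] by (simp add: scaleC_one one)
  next
    case (Cons x xs)
    from mult[OF gen this, of x] show ?case by (simp add: gen_def mult_single)
  qed
  then have "P (Poly_Mapping.single w 1)"
    by (cases w) simp
  from mult[OF scalar this, of c] show ?case
    by (simp add: mult_scaleC_left scaleC_single scaleC_complex_def)
qed (rule add)

text \<open>The kernel of \<open>f\<close> is a two-sided ideal containing \<open>R\<close>, hence
  contains the ideal generated by \<open>R\<close>. The surjection \<open>q\<close> is kept abstract
  so that one proof serves all four quotient types, with \<open>q\<close> the respective abstraction
  map.\<close>

lemma quotient_lift:
  assumes q: "algebra_hom q" "surj q" and ker: "\<And>x y. q x = q y \<longleftrightarrow> ideal_cong R x y"
    and f: "algebra_hom f" "\<And>r. r \<in> R \<Longrightarrow> f r = 0"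
  shows "\<exists>g. algebra_hom g \<and> (\<forall>x. g (q x) = f x)"
proof -
  have "two_sided_ideal {x. f x = 0}"
    by (simp add: two_sided_ideal_def algebra_hom_simps[OF f(1)])
  then have "two_sided_ideal hull R \<subseteq> {x. f x = 0}"
    using f(2) by (intro hull_minimal) auto
  then have cong: "f x = f y" if "q x = q y" for x y
    using that ker[of x y] algebra_hom_simps(6)[OF f(1), of x y] by (auto simp: ideal_cong_def)
  define g where "g z = f (inv q z)" for z
  have g: "g (q x) = f x" for x
    unfolding g_def using surj_f_inv_f[OF q(2)] by (rule cong)
  have "algebra_hom g"
  proof (rule algebra_homI)
    fix z w c
    obtain x y where "z = q x" "w = q y"
      using q(2) by (metis surjD)
    then show "g (z + w) = g z + g w" "g (c *\<^sub>C z) = c *\<^sub>C g z" "g (z * w) = g z * g w"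
      by (simp_all add: algebra_hom_simps(1,2,5)[OF q(1), symmetric] g algebra_hom_simps[OF f(1)])
  next
    show "g 1 = 1"
      using g[of 1] by (simp add: algebra_hom_simps(4)[OF q(1)] algebra_hom_simps(4)[OF f(1)])
  qed
  with g show ?thesis by blast
qed

lemma quotient_relation:
  assumes "\<And>x y. q x = q y \<longleftrightarrow> ideal_cong R x y" and "algebra_hom q" and "r \<in> R"
  shows "q r = 0"
proof -
  have "ideal_cong R r 0"
    using hull_subset[of R two_sided_ideal] assms(3) by (auto simp: ideal_cong_def)
  then show ?thesis
    using assms(1)[of r 0] algebra_hom_simps(3)[OF assms(2)] by simp
qed

text \<open>This lemma and the next are converse to each other. This direction supplies the
  vanishing needed by \<open>quotient_lift\<close>; the other shows that the canonical maps into
  free powers and free products are homomorphisms.\<close>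

lemma hom_relations_vanish:
  assumes "algebra_hom F" "algebra_hom (\<lambda>a. F (j a))" "r \<in> hom_relations j"
  shows "F r = 0"
  using assms(3) algebra_hom_simps[OF assms(2)]
  by (auto simp: hom_relations_def algebra_hom_simps[OF assms(1)])

lemma algebra_hom_if_hom_relations_vanish:
  assumes F: "algebra_hom F" and "\<And>r. r \<in> hom_relations j \<Longrightarrow> F r = 0"
  shows "algebra_hom (\<lambda>a. F (j a))"
proof -
  have v: "F (j (a + b) - (j a + j b)) = 0" "F (j (c *\<^sub>C a) - c *\<^sub>C j a) = 0"
    "F (j (a * b) - j a * j b) = 0" "F (j 1 - 1) = 0" for a b c
    by (rule assms(2); unfold hom_relations_def; blast)+
  show ?thesis
    by (rule algebra_homI) (use v in \<open>simp_all add: algebra_hom_simps[OF F]\<close>)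
qed

section \<open>Free powers of an algebra\<close>

lemma algebra_hom_abs_free_power: "algebra_hom abs_free_power"
  by (rule algebra_homI)
    (simp_all add: plus_free_power.abs_eq scaleC_free_power.abs_eq one_free_power.abs_eq
      times_free_power.abs_eq)

lemma algebra_hom_free_power_embed: "algebra_hom (free_power_embed i)"
  unfolding free_power_embed.abs_eq
  by (intro algebra_hom_if_hom_relations_vanish[OF algebra_hom_abs_free_power]
      quotient_relation[OF free_power.abs_eq_iff algebra_hom_abs_free_power])
    (auto simp: free_power_relations_def)

lemma free_power_lift:
  fixes f :: "'n \<Rightarrow> 'a::complex_unital_algebra \<Rightarrow> 'b::complex_unital_algebra"
  assumes "\<And>i. algebra_hom (f i)"
  shows "\<exists>g. algebra_hom g \<and> (\<forall>i a. g (free_power_embed i a) = f i a)"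
proof -
  let ?F = "free_lift (\<lambda>(i, a). f i a)"
  have "?F r = 0" if "r \<in> free_power_relations" for r
    using that unfolding free_power_relations_def
    by (auto intro!: hom_relations_vanish[OF algebra_hom_free_lift] simp: free_lift_gen assms)
  from quotient_lift[OF algebra_hom_abs_free_power _ free_power.abs_eq_iff algebra_hom_free_lift this]
  obtain g where "algebra_hom g" "\<And>x. g (abs_free_power x) = ?F x"
    by (metis surjI Quotient3_abs_rep[OF Quotient3_free_power])
  then show ?thesis
    by (intro exI[of _ g]) (simp add: free_power_embed.abs_eq free_lift_gen)
qed

lemma free_power_induct [case_names scalar embed add mult]:
  assumes "\<And>c. P (c *\<^sub>C 1)" "\<And>i a. P (free_power_embed i a)"
    "\<And>p q. P p \<Longrightarrow> P q \<Longrightarrow> P (p + q)" "\<And>p q. P p \<Longrightarrow> P q \<Longrightarrow> P (p * q)"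
  shows "P t"
proof (induction t rule: free_power.abs_induct)
  case (1 p)
  show ?case
    by (induction p rule: free_algebra_induct)
      (use assms in \<open>auto simp: algebra_hom_simps[OF algebra_hom_abs_free_power]
        free_power_embed.abs_eq[symmetric]\<close>)
qed

section \<open>The quantum permutation algebra\<close>

lemma algebra_hom_abs_quantum_perm: "algebra_hom abs_quantum_perm"
  by (rule algebra_homI)
    (simp_all add: plus_quantum_perm.abs_eq scaleC_quantum_perm.abs_eq one_quantum_perm.abs_eq
      times_quantum_perm.abs_eq)

text \<open>Both directions are used: from right to left for the universal property, and from left
  to right, with \<open>F\<close> the quotient map, for the relations between the
  generators.\<close>

lemma quantum_perm_relations_vanish_iff:
  assumes F: "algebra_hom F" and x: "\<And>i j. F (gen (i, j)) = x i j"
  shows "(\<forall>r\<in>quantum_perm_relations. F r = 0) \<longleftrightarrow>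
    (\<forall>i j k. x i j * x i k = (if j = k then x i j else 0)) \<and>
    (\<forall>i j k. x j i * x k i = (if j = k then x j i else 0)) \<and>
    (\<forall>i. (\<Sum>l\<in>UNIV. x i l) = 1) \<and> (\<forall>i. (\<Sum>l\<in>UNIV. x l i) = 1)"
  (is "?L \<longleftrightarrow> ?R")
proof -
  have "F (gen (i, j) * gen (i, k) - (if j = k then gen (i, j) else 0)) =
      x i j * x i k - (if j = k then x i j else 0)"
    "F (gen (j, i) * gen (k, i) - (if j = k then gen (j, i) else 0)) =
      x j i * x k i - (if j = k then x j i else 0)"
    "F ((\<Sum>l\<in>UNIV. gen (i, l)) - 1) = (\<Sum>l\<in>UNIV. x i l) - 1"
    "F ((\<Sum>l\<in>UNIV. gen (l, i)) - 1) = (\<Sum>l\<in>UNIV. x l i) - 1" for i j k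
    by (simp_all add: algebra_hom_simps[OF F] x)
  note eqs = this
  have ball: "(\<forall>r\<in>{g i j k | i j k. True}. F r = 0) \<longleftrightarrow> (\<forall>i j k. F (g i j k) = 0)"
    "(\<forall>r\<in>{g' i | i. True}. F r = 0) \<longleftrightarrow> (\<forall>i. F (g' i) = 0)"
    for g :: "'a \<Rightarrow> 'a \<Rightarrow> 'a \<Rightarrow> ('a \<times> 'a) free_algebra" and g'
    by blast+
  have "?L \<longleftrightarrow>
    (\<forall>i j k. x i j * x i k - (if j = k then x i j else 0) = 0) \<and>
    (\<forall>i j k. x j i * x k i - (if j = k then x j i else 0) = 0) \<and>
    (\<forall>i. (\<Sum>l\<in>UNIV. x i l) - 1 = 0) \<and> (\<forall>i. (\<Sum>l\<in>UNIV. x l i) - 1 = 0)"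
    unfolding quantum_perm_relations_def Let_def ball_Un ball eqs by (simp only: conj_assoc)
  then show ?thesis by simp
qed

lemma quantum_perm_lift:
  fixes x :: "'n::finite \<Rightarrow> 'n \<Rightarrow> 'b::complex_unital_algebra"
  assumes "\<And>i j k. x i j * x i k = (if j = k then x i j else 0)"
    "\<And>i j k. x j i * x k i = (if j = k then x j i else 0)"
    "\<And>i. (\<Sum>l\<in>UNIV. x i l) = 1" "\<And>i. (\<Sum>l\<in>UNIV. x l i) = 1"
  shows "\<exists>g. algebra_hom g \<and> (\<forall>i j. g (quantum_perm_gen i j) = x i j)"
proof -
  let ?F = "free_lift (\<lambda>(i, j). x i j)"
  have gen: "?F (gen (i, j)) = x i j" for i j
    by (simp add: free_lift_gen)
  have "?F r = 0" if "r \<in> quantum_perm_relations" for r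
    using that quantum_perm_relations_vanish_iff[OF algebra_hom_free_lift gen] assms by blast
  from quotient_lift[OF algebra_hom_abs_quantum_perm _ quantum_perm.abs_eq_iff
      algebra_hom_free_lift this]
  obtain g where "algebra_hom g" "\<And>x. g (abs_quantum_perm x) = ?F x"
    by (metis surjI Quotient3_abs_rep[OF Quotient3_quantum_perm])
  then show ?thesis
    by (intro exI[of _ g]) (simp add: quantum_perm_gen.abs_eq free_lift_gen)
qed

lemma quantum_perm_gen_relations:
  "quantum_perm_gen i j * quantum_perm_gen i k = (if j = k then quantum_perm_gen i j else 0)"
  "quantum_perm_gen j i * quantum_perm_gen k i = (if j = k then quantum_perm_gen j i else 0)"
  "(\<Sum>l\<in>UNIV. quantum_perm_gen i l) = 1" "(\<Sum>l\<in>UNIV. quantum_perm_gen l i) = 1"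
proof -
  have "\<forall>r\<in>quantum_perm_relations. abs_quantum_perm r = 0"
    using quotient_relation[OF quantum_perm.abs_eq_iff algebra_hom_abs_quantum_perm] by blast
  from this[unfolded quantum_perm_relations_vanish_iff[where x = quantum_perm_gen,
        OF algebra_hom_abs_quantum_perm quantum_perm_gen.abs_eq[symmetric]]]
  show "quantum_perm_gen i j * quantum_perm_gen i k = (if j = k then quantum_perm_gen i j else 0)"
    "quantum_perm_gen j i * quantum_perm_gen k i = (if j = k then quantum_perm_gen j i else 0)"
    "(\<Sum>l\<in>UNIV. quantum_perm_gen i l) = 1" "(\<Sum>l\<in>UNIV. quantum_perm_gen l i) = 1"
    by blast+
qed

lemma quantum_perm_induct [case_names scalar gen add mult]:
  assumes "\<And>c. P (c *\<^sub>C 1)" "\<And>i j. P (quantum_perm_gen i j)"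
    "\<And>p q. P p \<Longrightarrow> P q \<Longrightarrow> P (p + q)" "\<And>p q. P p \<Longrightarrow> P q \<Longrightarrow> P (p * q)"
  shows "P t"
proof (induction t rule: quantum_perm.abs_induct)
  case (1 p)
  show ?case
    by (induction p rule: free_algebra_induct)
      (use assms in \<open>auto simp: algebra_hom_simps[OF algebra_hom_abs_quantum_perm]
        quantum_perm_gen.abs_eq[symmetric]\<close>)
qed

section \<open>Free products of two algebras\<close>

lemma algebra_hom_abs_free_product: "algebra_hom abs_free_product"
  by (rule algebra_homI)
    (simp_all add: plus_free_product.abs_eq scaleC_free_product.abs_eq one_free_product.abs_eq
      times_free_product.abs_eq)

lemma algebra_hom_free_product_inl: "algebra_hom free_product_inl"
  unfolding free_product_inl.abs_eq
  by (intro algebra_hom_if_hom_relations_vanish[OF algebra_hom_abs_free_product]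
      quotient_relation[OF free_product.abs_eq_iff algebra_hom_abs_free_product])
    (simp add: free_product_relations_def)

lemma algebra_hom_free_product_inr: "algebra_hom free_product_inr"
  unfolding free_product_inr.abs_eq
  by (intro algebra_hom_if_hom_relations_vanish[OF algebra_hom_abs_free_product]
      quotient_relation[OF free_product.abs_eq_iff algebra_hom_abs_free_product])
    (simp add: free_product_relations_def)

lemma free_product_lift:
  fixes f :: "'a::complex_unital_algebra \<Rightarrow> 'c::complex_unital_algebra"
    and g :: "'b::complex_unital_algebra \<Rightarrow> 'c"
  assumes "algebra_hom f" "algebra_hom g"
  shows "\<exists>h. algebra_hom h \<and> (\<forall>a. h (free_product_inl a) = f a) \<and> (\<forall>b. h (free_product_inr b) = g b)"
proof -
  let ?F = "free_lift (case_sum f g)"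
  have "algebra_hom (\<lambda>a. ?F (gen (Inl a)))" "algebra_hom (\<lambda>b. ?F (gen (Inr b)))"
    by (simp_all add: free_lift_gen assms)
  note vanish = this[THEN hom_relations_vanish[OF algebra_hom_free_lift]]
  have "?F r = 0" if "r \<in> free_product_relations" for r
    using that vanish unfolding free_product_relations_def by blast
  from quotient_lift[OF algebra_hom_abs_free_product _ free_product.abs_eq_iff
      algebra_hom_free_lift this]
  obtain h where "algebra_hom h" "\<And>x. h (abs_free_product x) = ?F x"
    by (metis surjI Quotient3_abs_rep[OF Quotient3_free_product])
  then show ?thesis
    by (intro exI[of _ h]) (simp add: free_product_inl.abs_eq free_product_inr.abs_eq free_lift_gen)
qed

lemma free_product_induct [case_names scalar inl inr add mult]:
  assumes "\<And>c. P (c *\<^sub>C 1)" "\<And>a. P (free_product_inl a)" "\<And>b. P (free_product_inr b)"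
    "\<And>p q. P p \<Longrightarrow> P q \<Longrightarrow> P (p + q)" "\<And>p q. P p \<Longrightarrow> P q \<Longrightarrow> P (p * q)"
  shows "P t"
proof (induction t rule: free_product.abs_induct)
  case (1 p)
  show ?case
  proof (induction p rule: free_algebra_induct)
    case (gen x)
    show ?case
      by (cases x)
        (use assms in \<open>auto simp: free_product_inl.abs_eq[symmetric] free_product_inr.abs_eq[symmetric]\<close>)
  qed (use assms in \<open>auto simp: algebra_hom_simps[OF algebra_hom_abs_free_product]\<close>)
qed

section \<open>The free wreath product as an algebra\<close>

lemma algebra_hom_abs_free_wreath: "algebra_hom abs_free_wreath"
  by (rule algebra_homI)
    (simp_all add: plus_free_wreath.abs_eq scaleC_free_wreath.abs_eq one_free_wreath.abs_eq
      times_free_wreath.abs_eq)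

lemma algebra_hom_wreath_nu: "algebra_hom (wreath_nu i)"
  unfolding wreath_nu.abs_eq
  by (intro algebra_hom_comp[OF algebra_hom_abs_free_wreath]
      algebra_hom_comp[OF algebra_hom_free_product_inl] algebra_hom_free_power_embed)

lemma wreath_x_row: "wreath_x i j * wreath_x i k = (if j = k then wreath_x i j else 0)"
  and wreath_x_column: "wreath_x j i * wreath_x k i = (if j = k then wreath_x j i else 0)"
  and wreath_x_row_sum: "(\<Sum>l\<in>UNIV. wreath_x i l) = 1"
  and wreath_x_column_sum: "(\<Sum>l\<in>UNIV. wreath_x l i) = 1"
proof -
  have h: "algebra_hom (\<lambda>q. abs_free_wreath (free_product_inr q))"
    by (rule algebra_hom_comp[OF algebra_hom_abs_free_wreath algebra_hom_free_product_inr])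
  note s = algebra_hom_simps[OF h, symmetric]
  show "wreath_x i j * wreath_x i k = (if j = k then wreath_x i j else 0)"
    "wreath_x j i * wreath_x k i = (if j = k then wreath_x j i else 0)"
    "(\<Sum>l\<in>UNIV. wreath_x i l) = 1" "(\<Sum>l\<in>UNIV. wreath_x l i) = 1"
    unfolding wreath_x.abs_eq s(5) s(7) quantum_perm_gen_relations
    by (simp_all add: algebra_hom_simps(3,4)[OF h])
qed

lemma wreath_commute: "wreath_nu k a * wreath_x k i = wreath_x k i * wreath_nu k a"
proof -
  have "abs_free_wreath (free_product_inl (free_power_embed k a) * free_product_inr (quantum_perm_gen k i) -
      free_product_inr (quantum_perm_gen k i) * free_product_inl (free_power_embed k a)) = 0"
    by (rule quotient_relation[OF free_wreath.abs_eq_iff algebra_hom_abs_free_wreath])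
      (auto simp: free_wreath_relations_def)
  then show ?thesis
    by (simp add: wreath_nu.abs_eq wreath_x.abs_eq algebra_hom_simps[OF algebra_hom_abs_free_wreath])
qed

lemma free_wreath_lift:
  fixes f :: "'n::finite \<Rightarrow> 'a::complex_unital_algebra \<Rightarrow> 'b::complex_unital_algebra"
  assumes f: "\<And>i. algebra_hom (f i)"
    and x: "\<And>i j k. x i j * x i k = (if j = k then x i j else 0)"
      "\<And>i j k. x j i * x k i = (if j = k then x j i else 0)"
      "\<And>i. (\<Sum>l\<in>UNIV. x i l) = 1" "\<And>i. (\<Sum>l\<in>UNIV. x l i) = 1"
    and comm: "\<And>i k a. f k a * x k i = x k i * f k a"
  shows "\<exists>g. algebra_hom g \<and> (\<forall>i a. g (wreath_nu i a) = f i a) \<and> (\<forall>i j. g (wreath_x i j) = x i j)"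
proof -
  obtain g1 where g1: "algebra_hom g1" "\<And>i a. g1 (free_power_embed i a) = f i a"
    using free_power_lift[of f] f by blast
  obtain g2 where g2: "algebra_hom g2" "\<And>i j. g2 (quantum_perm_gen i j) = x i j"
    using quantum_perm_lift[of x] x by blast
  obtain h where h: "algebra_hom h" "\<And>a. h (free_product_inl a) = g1 a"
    "\<And>b. h (free_product_inr b) = g2 b"
    using free_product_lift[OF g1(1) g2(1)] by blast
  have "h r = 0" if "r \<in> free_wreath_relations" for r
    using that by (auto simp: free_wreath_relations_def algebra_hom_simps[OF h(1)] h g1 g2 comm)
  from quotient_lift[OF algebra_hom_abs_free_wreath _ free_wreath.abs_eq_iff h(1) this]
  obtain g where "algebra_hom g" "\<And>x. g (abs_free_wreath x) = h x"
    by (metis surjI Quotient3_abs_rep[OF Quotient3_free_wreath])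
  then show ?thesis
    by (intro exI[of _ g]) (simp add: wreath_nu.abs_eq wreath_x.abs_eq h g1 g2)
qed

lemma free_wreath_induct [case_names nu x add mult]:
  assumes nu: "\<And>i a. P (wreath_nu i a)" and x: "\<And>i j. P (wreath_x i j)"
    and add: "\<And>p q. P p \<Longrightarrow> P q \<Longrightarrow> P (p + q)" and mult: "\<And>p q. P p \<Longrightarrow> P q \<Longrightarrow> P (p * q)"
  shows "P (t :: ('a::complex_unital_algebra, 'n::finite) free_wreath)"
proof -
  \<comment> \<open>Scalars lie in the range of every \<open>wreath_nu i\<close>. Some index exists
    because types are nonempty, which is the condition n >= 1.\<close>
  have scalar: "P (c *\<^sub>C 1)" for c
    using nu[of undefined "c *\<^sub>C 1"] by (simp add: algebra_hom_simps[OF algebra_hom_wreath_nu])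
  note simps = algebra_hom_simps[OF algebra_hom_abs_free_wreath]
    algebra_hom_simps[OF algebra_hom_free_product_inl] algebra_hom_simps[OF algebra_hom_free_product_inr]
  have inl: "P (abs_free_wreath (free_product_inl q))" for q
    by (induction q rule: free_power_induct)
      (auto simp: simps wreath_nu.abs_eq[symmetric] intro: scalar nu add mult)
  have inr: "P (abs_free_wreath (free_product_inr q))" for q
    by (induction q rule: quantum_perm_induct)
      (auto simp: simps wreath_x.abs_eq[symmetric] intro: scalar x add mult)
  show ?thesis
  proof (induction t rule: free_wreath.abs_induct)
    case (1 q)
    show ?case
      by (induction q rule: free_product_induct) (auto simp: simps intro: scalar inl inr add mult)
  qed
qed

section \<open>Opposite and conjugate algebras\<close>

text \<open>The multiplication of an algebra is fixed by its type, so reversing it takes a new type.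
  A product-reversing map then becomes an \<open>algebra_hom\<close>, to which
  \<open>free_wreath_lift\<close> applies.\<close>

typedef 'a opposite = "UNIV :: 'a set" morphisms of_opposite opposite ..

setup_lifting type_definition_opposite

instantiation opposite :: (complex_unital_algebra) complex_unital_algebra
begin

lift_definition zero_opposite :: "'a opposite" is 0 .
lift_definition one_opposite :: "'a opposite" is 1 .
lift_definition plus_opposite :: "'a opposite \<Rightarrow> 'a opposite \<Rightarrow> 'a opposite" is "(+)" .
lift_definition uminus_opposite :: "'a opposite \<Rightarrow> 'a opposite" is uminus .
lift_definition minus_opposite :: "'a opposite \<Rightarrow> 'a opposite \<Rightarrow> 'a opposite" is "(-)" .
lift_definition times_opposite :: "'a opposite \<Rightarrow> 'a opposite \<Rightarrow> 'a opposite" is "\<lambda>x y. y * x" .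
lift_definition scaleC_opposite :: "complex \<Rightarrow> 'a opposite \<Rightarrow> 'a opposite" is scaleC .

instance
  by standard
    (transfer; simp add: algebra_simps mult.assoc scaleC_add_right scaleC_add_left scaleC_scaleC
      scaleC_one mult_scaleC_left mult_scaleC_right)+

end

text \<open>The same device for scalars: a conjugate linear map becomes linear. Placed on top of
  \<open>opposite\<close>, it makes an involution an \<open>algebra_hom\<close>.\<close>

typedef 'a conjugate = "UNIV :: 'a set" morphisms of_conjugate conjugate ..

setup_lifting type_definition_conjugate

instantiation conjugate :: (complex_unital_algebra) complex_unital_algebra
begin

lift_definition zero_conjugate :: "'a conjugate" is 0 .
lift_definition one_conjugate :: "'a conjugate" is 1 .
lift_definition plus_conjugate :: "'a conjugate \<Rightarrow> 'a conjugate \<Rightarrow> 'a conjugate" is "(+)" .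
lift_definition uminus_conjugate :: "'a conjugate \<Rightarrow> 'a conjugate" is uminus .
lift_definition minus_conjugate :: "'a conjugate \<Rightarrow> 'a conjugate \<Rightarrow> 'a conjugate" is "(-)" .
lift_definition times_conjugate :: "'a conjugate \<Rightarrow> 'a conjugate \<Rightarrow> 'a conjugate" is "(*)" .
lift_definition scaleC_conjugate :: "complex \<Rightarrow> 'a conjugate \<Rightarrow> 'a conjugate" is "\<lambda>c. scaleC (cnj c)" .

instance
  by standard
    (transfer; simp add: algebra_simps mult.assoc scaleC_add_right scaleC_add_left scaleC_scaleC
      scaleC_one mult_scaleC_left mult_scaleC_right)+

end

lemma opposite_simps:
  "opposite x * opposite y = opposite (y * x)" "1 = opposite 1" "0 = opposite 0"
  "opposite x + opposite y = opposite (x + y)" "c *\<^sub>C opposite x = opposite (c *\<^sub>C x)"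
  by (simp_all add: of_opposite_inject[symmetric] opposite_inverse times_opposite.rep_eq
      one_opposite.rep_eq zero_opposite.rep_eq plus_opposite.rep_eq scaleC_opposite.rep_eq)

lemma opposite_sum: "(\<Sum>i\<in>I. opposite (f i)) = opposite (\<Sum>i\<in>I. f i)"
  by (induction I rule: infinite_finite_induct) (simp_all add: opposite_simps)

lemma conjugate_simps:
  "conjugate x * conjugate y = conjugate (x * y)" "1 = conjugate 1" "0 = conjugate 0"
  "conjugate x + conjugate y = conjugate (x + y)" "c *\<^sub>C conjugate x = conjugate (cnj c *\<^sub>C x)"
  by (simp_all add: of_conjugate_inject[symmetric] conjugate_inverse times_conjugate.rep_eq
      one_conjugate.rep_eq zero_conjugate.rep_eq plus_conjugate.rep_eq scaleC_conjugate.rep_eq)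

lemma conjugate_sum: "(\<Sum>i\<in>I. conjugate (f i)) = conjugate (\<Sum>i\<in>I. f i)"
  by (induction I rule: infinite_finite_induct) (simp_all add: conjugate_simps)

section \<open>Linear maps on tensor products\<close>

definition cbilinear ::
  "('a::complex_vector \<Rightarrow> 'b::complex_vector \<Rightarrow> 'c::complex_vector) \<Rightarrow> bool" where
  "cbilinear h \<longleftrightarrow> (\<forall>b. clinear (\<lambda>a. h a b)) \<and> (\<forall>a. clinear (h a))"

lemma cbilinearI:
  "(\<And>b. clinear (\<lambda>a. h a b)) \<Longrightarrow> (\<And>a. clinear (\<lambda>b. h a b)) \<Longrightarrow> cbilinear h"
  by (simp add: cbilinear_def)

lemma cbilinear_balanced: "cbilinear h \<Longrightarrow> balanced h"
  by (simp add: cbilinear_def balanced_def clinear_iff)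

lemma tensor_lift_pure: "cbilinear h \<Longrightarrow> tensor_lift h (a \<otimes> b) = h a b"
  by (intro tensor_lift_tensor cbilinear_balanced)

lemma clinear_tensor_lift:
  assumes "cbilinear h"
  shows "clinear (tensor_lift h)"
proof -
  note add = tensor_lift_add[OF cbilinear_balanced[OF assms]]
  have 0: "tensor_lift h 0 = 0"
    using add[of 0 0] by simp
  have "tensor_lift h (c *\<^sub>C t) = c *\<^sub>C tensor_lift h t" for c t
  proof (induction t rule: tensor_induct)
    case (tensor a b)
    then show ?case
      using assms by (simp add: tensor_scaleC_left[symmetric] tensor_lift_pure)
        (simp add: cbilinear_def clinear_iff)
  qed (simp_all add: 0 add scaleC_add_right)
  with add show ?thesis
    by (simp add: clinear_iff)
qed

lemma clinear_ident: "clinear (\<lambda>x. x)"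
  by (simp add: clinear_iff)

lemma clinear_compose: "clinear g \<Longrightarrow> clinear f \<Longrightarrow> clinear (\<lambda>x. g (f x))"
  by (simp add: clinear_iff)

lemma clinear_sum_fun: "(\<And>i. clinear (f i)) \<Longrightarrow> clinear (\<lambda>x. \<Sum>i\<in>I. f i x)"
  by (simp add: clinear_iff sum.distrib complex_vector.scale_sum_right)

lemma clinear_scaleC_const: "clinear f \<Longrightarrow> clinear (\<lambda>x. c *\<^sub>C f x)"
  by (simp add: clinear_iff scaleC_add_right scaleC_scaleC mult.commute)

lemma clinear_scaleC_fun: "clinear f \<Longrightarrow> clinear (\<lambda>x. f x *\<^sub>C v)"
  unfolding clinear_iff by (simp add: scaleC_add_left scaleC_scaleC scaleC_complex_def)

lemma clinear_mult_left: "clinear f \<Longrightarrow> clinear (\<lambda>x. f x * k)" for k :: "'a::complex_algebra"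
  by (simp add: clinear_iff distrib_right mult_scaleC_left)

lemma clinear_mult_right: "clinear f \<Longrightarrow> clinear (\<lambda>x. k * f x)" for k :: "'a::complex_algebra"
  by (simp add: clinear_iff distrib_left mult_scaleC_right)

lemma clinear_tensor_left: "clinear f \<Longrightarrow> clinear (\<lambda>x. f x \<otimes> k)"
  by (simp add: clinear_iff tensor_add_left tensor_scaleC_left)

lemma clinear_tensor_right: "clinear f \<Longrightarrow> clinear (\<lambda>x. k \<otimes> f x)"
  by (simp add: clinear_iff tensor_add_right tensor_scaleC_right)

lemma clinear_tensor_lift_arg: "cbilinear h \<Longrightarrow> clinear f \<Longrightarrow> clinear (\<lambda>x. tensor_lift h (f x))"
  by (rule clinear_compose[OF clinear_tensor_lift])

text \<open>This replaces Sweedler notation: once \<open>comult a\<close> has been generalized to an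
  arbitrary \<open>t\<close>, both sides are linear in \<open>t\<close> and pure tensors
  decide.\<close>

lemma tensor_ext:
  assumes "clinear f" "clinear g" "\<And>a b. f (a \<otimes> b) = g (a \<otimes> b)"
  shows "f t = g t"
  using assms by (induction t rule: tensor_induct) (simp_all add: clinear_0 clinear_iff)

text \<open>Nested lifts such as \<open>tensor_assoc\<close> require linearity in a parameter of the
  bilinear map while the tensor stays fixed; induction on that tensor reduces this to pure
  tensors.\<close>

lemma clinear_tensor_lift_param:
  assumes "\<And>x. cbilinear (h x)" "\<And>a b. clinear (\<lambda>x. h x a b)"
  shows "clinear (\<lambda>x. tensor_lift (h x) t)"
proof (induction t rule: tensor_induct)
  case zero
  have "tensor_lift (h x) 0 = 0" for x
    using assms(1) by (intro clinear_0 clinear_tensor_lift)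
  then show ?case by (simp add: clinear_iff)
next
  case (tensor a b)
  then show ?case using assms by (simp add: tensor_lift_pure)
next
  case (add s t)
  have "tensor_lift (h x) (s + t) = tensor_lift (h x) s + tensor_lift (h x) t" for x
    by (rule tensor_lift_add[OF cbilinear_balanced[OF assms(1)]])
  then show ?case using add by (simp add: clinear_iff scaleC_add_right)
qed

lemmas clinear_intros = clinear_ident clinear_sum_fun clinear_scaleC_const clinear_scaleC_fun
  clinear_mult_left clinear_mult_right clinear_tensor_left clinear_tensor_right cbilinearI
  clinear_tensor_lift_arg clinear_tensor_lift_param

lemma tensor_sum_left: "(\<Sum>i\<in>I. f i) \<otimes> b = (\<Sum>i\<in>I. f i \<otimes> b)"
  by (rule clinear_sum[OF clinear_tensor_left[OF clinear_ident]])

lemma tensor_sum_right: "a \<otimes> (\<Sum>i\<in>I. f i) = (\<Sum>i\<in>I. a \<otimes> f i)"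
  by (rule clinear_sum[OF clinear_tensor_right[OF clinear_ident]])

lemma tensor_zero: "0 \<otimes> b = 0" "a \<otimes> 0 = 0"
  using tensor_sum_left[of _ "{}" b] tensor_sum_right[of a _ "{}"] by simp_all

lemma tensor_if:
  "(if P then a else 0) \<otimes> b = (if P then a \<otimes> b else 0)"
  "a \<otimes> (if P then b else 0) = (if P then a \<otimes> b else 0)"
  by (simp_all add: tensor_zero)

lemma mult_if:
  "(if P then a else 0) * b = (if P then a * b else 0)"
  "b * (if P then a else 0) = (if P then b * a else 0)" for a b :: "'a::ring"
  by simp_all

lemma cbilinear_tensor_map:
  "clinear f \<Longrightarrow> clinear g \<Longrightarrow> cbilinear (\<lambda>a b. f a \<otimes> g b)"
  by (intro cbilinearI clinear_tensor_left clinear_tensor_right)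

lemma tensor_map_pure: "clinear f \<Longrightarrow> clinear g \<Longrightarrow> tensor_map f g (a \<otimes> b) = f a \<otimes> g b"
  by (simp add: tensor_map_def tensor_lift_pure cbilinear_tensor_map)

lemma clinear_tensor_map: "clinear f \<Longrightarrow> clinear g \<Longrightarrow> clinear (tensor_map f g)"
  by (simp add: tensor_map_def clinear_tensor_lift cbilinear_tensor_map)

lemma clinear_id: "clinear id"
  by (simp add: clinear_iff)

lemma clinear_tensor_map_arg:
  "clinear f \<Longrightarrow> clinear g \<Longrightarrow> clinear h \<Longrightarrow> clinear (\<lambda>x. tensor_map f g (h x))"
  by (rule clinear_compose[OF clinear_tensor_map])

lemma algebra_hom_tensorI:
  fixes f :: "('a::complex_unital_algebra, 'b::complex_unital_algebra) tensor \<Rightarrow> 'c::complex_unital_algebra"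
  assumes f: "clinear f" and one: "f (1 \<otimes> 1) = 1"
    and mult: "\<And>a b a' b'. f ((a * a') \<otimes> (b * b')) = f (a \<otimes> b) * f (a' \<otimes> b')"
  shows "algebra_hom f"
proof (rule algebra_homI)
  show "f 1 = 1" by (simp add: one_tensor_def one)
  show "f (s * t) = f s * f t" for s t
  proof (induction s rule: tensor_induct)
    case (tensor a b)
    show ?case
      by (induction t rule: tensor_induct)
        (use f in \<open>simp_all add: clinear_0 clinear_iff tensor_mult_tensor mult distrib_left\<close>)
  qed (use f in \<open>simp_all add: clinear_0 clinear_iff distrib_right\<close>)
qed (use f in \<open>simp_all add: clinear_iff\<close>)

lemma algebra_hom_tensor_map:
  assumes "algebra_hom f" "algebra_hom g"
  shows "algebra_hom (tensor_map f g)"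
  by (rule algebra_hom_tensorI)
    (simp_all add: clinear_tensor_map tensor_map_pure algebra_hom_clinear assms tensor_mult_tensor
      algebra_hom_simps[OF assms(1)] algebra_hom_simps[OF assms(2)] one_tensor_def)

lemma cbilinear_tensor_assoc_inner: "cbilinear (\<lambda>a b. a \<otimes> b \<otimes> c)"
  by (intro clinear_intros)

lemma cbilinear_tensor_assoc_outer: "cbilinear (\<lambda>t c. tensor_lift (\<lambda>a b. a \<otimes> b \<otimes> c) t)"
  by (intro clinear_intros)

lemma tensor_assoc_tensor: "tensor_assoc (t \<otimes> c) = tensor_lift (\<lambda>a b. a \<otimes> b \<otimes> c) t"
  by (simp add: tensor_assoc_def tensor_lift_pure cbilinear_tensor_assoc_outer)

lemma tensor_assoc_pure: "tensor_assoc ((a \<otimes> b) \<otimes> c) = a \<otimes> b \<otimes> c"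
  by (simp add: tensor_assoc_tensor tensor_lift_pure cbilinear_tensor_assoc_inner)

lemma clinear_tensor_assoc: "clinear tensor_assoc"
  unfolding tensor_assoc_def by (intro clinear_tensor_lift cbilinear_tensor_assoc_outer)

text \<open>This makes both sides of the coassociativity law homomorphisms. The first leg is itself
  a tensor, so each of the two factors needs its own induction.\<close>

lemma algebra_hom_tensor_assoc:
  "algebra_hom (tensor_assoc :: (('a::complex_unital_algebra, 'b::complex_unital_algebra) tensor,
     'c::complex_unital_algebra) tensor \<Rightarrow> _)"
proof (rule algebra_hom_tensorI[OF clinear_tensor_assoc])
  fix s t :: "('a, 'b) tensor" and c c' :: 'c
  note lin = clinear_tensor_assoc[unfolded clinear_iff] clinear_0[OF clinear_tensor_assoc]
  have 0: "(0 \<otimes> c) = 0" for c :: 'c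
    using clinear_0[OF clinear_tensor_left[OF clinear_ident]] .
  show "tensor_assoc ((s * t) \<otimes> (c * c')) = tensor_assoc (s \<otimes> c) * tensor_assoc (t \<otimes> c')"
  proof (induction s rule: tensor_induct)
    case (tensor a b)
    show ?case
      by (induction t rule: tensor_induct)
        (simp_all add: 0 lin tensor_add_left tensor_assoc_pure tensor_mult_tensor distrib_left)
  qed (simp_all add: 0 lin tensor_add_left distrib_right)
qed (simp add: one_tensor_def tensor_assoc_pure)

lemmas clinear_tensor_intros = clinear_tensor_map clinear_id clinear_tensor_map_arg
  clinear_tensor_assoc clinear_compose[OF clinear_tensor_assoc]

section \<open>The antipode of a Hopf algebra\<close>

context hopf_algebra
begin

lemma comult_linear: "clinear comult" and counit_linear: "clinear counit"
  using comult_hom counit_hom by (simp_all add: algebra_hom_clinear)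

lemmas hopf_clinear_intros = clinear_intros clinear_tensor_intros antipode_linear comult_linear counit_linear
  clinear_compose[OF antipode_linear] clinear_compose[OF comult_linear]
  clinear_compose[OF counit_linear]

lemma antipode_one: "antipode 1 = 1"
  using antipode_left[of 1] algebra_hom_simps(4)[OF comult_hom] algebra_hom_simps(4)[OF counit_hom]
  by (simp add: one_tensor_def tensor_lift_pure hopf_clinear_intros scaleC_one)

text \<open>The antipode is the convolution inverse of the identity, so that \<open>f * id = g\<close> in the
  convolution algebra gives \<open>f = g * S\<close>.\<close>

lemma convolution_cancel:
  fixes f g :: "'a \<Rightarrow> 'a"
  assumes f: "clinear f" and g: "clinear g"
    and fg: "\<And>a. tensor_lift (\<lambda>b c. f b * c) (comult a) = g a"
  shows "f a = tensor_lift (\<lambda>b c. g b * antipode c) (comult a)"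
proof -
  note intros = hopf_clinear_intros f g clinear_compose[OF f] clinear_compose[OF g]
  let ?m = "tensor_lift (\<lambda>b c. b * antipode c)"
  \<comment> \<open>\<open>?K\<close> sends \<open>b \<otimes> c \<otimes> d\<close> to
    \<open>f b * (c * antipode d)\<close>. On the threefold coproduct, grouping the last two legs
    gives \<open>f\<close>, by \<open>antipode_right\<close> and the counit law; grouping the first
    two gives the convolution of \<open>g\<close> with the antipode, by \<open>fg\<close>.
    Coassociativity identifies the two.\<close>
  let ?K = "tensor_lift (\<lambda>b t. f b * ?m t)"
  have m: "cbilinear (\<lambda>b c. b * antipode c)" and K: "cbilinear (\<lambda>b t. f b * ?m t)"
    by (intro intros)+
  have f1: "f = (\<lambda>a. tensor_lift (\<lambda>b c. f (counit c *\<^sub>C b)) (comult a))"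
  proof
    fix a
    have "f (tensor_lift (\<lambda>b c. counit c *\<^sub>C b) t) = tensor_lift (\<lambda>b c. f (counit c *\<^sub>C b)) t" for t
      by (rule tensor_ext) (intro intros | subst tensor_lift_pure | rule refl)+
    then show "f a = tensor_lift (\<lambda>b c. f (counit c *\<^sub>C b)) (comult a)"
      by (metis counit_right)
  qed
  have c: "cbilinear (\<lambda>b c. f (counit c *\<^sub>C b))"
    by (intro intros)
  have left: "tensor_lift (\<lambda>b c. f (counit c *\<^sub>C b)) t = ?K (tensor_map id comult t)" for t
  proof (rule tensor_ext[of "\<lambda>t. tensor_lift _ t" "\<lambda>t. ?K (tensor_map id comult t)"])
    fix b c :: 'a
    have "tensor_map id comult (b \<otimes> c) = b \<otimes> comult c"
      by (simp add: tensor_map_pure comult_linear clinear_id)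
    moreover have "f (d *\<^sub>C b) = d *\<^sub>C f b" for d
      using f by (simp add: clinear_iff)
    ultimately show "tensor_lift (\<lambda>b c. f (counit c *\<^sub>C b)) (b \<otimes> c) = ?K (tensor_map id comult (b \<otimes> c))"
      by (simp add: tensor_lift_pure[OF K] tensor_lift_pure[OF c] antipode_right mult_scaleC_right)
  qed (intro intros)+
  have right: "?K (tensor_assoc (tensor_map comult id t)) = tensor_lift (\<lambda>b c. g b * antipode c) t" for t
  proof (rule tensor_ext[of "\<lambda>t. ?K (tensor_assoc (tensor_map comult id t))" "\<lambda>t. tensor_lift _ t"])
    fix b c :: 'a
    have "?K (tensor_assoc (s \<otimes> c)) = tensor_lift (\<lambda>b c. f b * c) s * antipode c" for s
      by (rule tensor_ext[of "\<lambda>s. ?K (tensor_assoc (s \<otimes> c))" "\<lambda>s. tensor_lift _ s * _"]; (intro intros)?)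
        (simp add: tensor_assoc_pure tensor_lift_pure[OF K] tensor_lift_pure[OF m]
            tensor_lift_pure intros mult.assoc)
    from this[of "comult b"]
    show "?K (tensor_assoc (tensor_map comult id (b \<otimes> c))) = tensor_lift (\<lambda>b c. g b * antipode c) (b \<otimes> c)"
      by (simp add: tensor_map_pure comult_linear clinear_id fg tensor_lift_pure intros)
  qed (intro intros)+
  show ?thesis
    by (subst f1) (simp only: left coassoc[symmetric] right)
qed

text \<open>Two applications of \<open>convolution_cancel\<close>, one in each variable. In Sweedler
  notation, the first yields S(a1 b) a2 = \<epsilon>(a) S(b), and the second cancels a2 from
  this.\<close>

lemma antipode_mult: "antipode (a * b) = antipode b * antipode a"
proof -
  \<comment> \<open>Here \<open>a\<close> is fixed and the left side is regarded as a function of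
    \<open>b\<close>; its convolution with the identity is
    \<open>counit (a * b) *\<^sub>C 1\<close>.\<close>
  have step: "tensor_lift (\<lambda>x y. antipode (x * b) * y) (comult a) = counit a *\<^sub>C antipode b" for a b
  proof -
    let ?f = "\<lambda>b. tensor_lift (\<lambda>x y. antipode (x * b) * y) (comult a)"
    have f: "clinear ?f"
      by (intro hopf_clinear_intros)
    \<comment> \<open>For \<open>s = comult a\<close> and \<open>t = comult b\<close> the product
      \<open>s * t\<close> is \<open>comult (a * b)\<close>, so the right side becomes the antipode
      law for \<open>a * b\<close>.\<close>
    have "tensor_lift (\<lambda>c d. tensor_lift (\<lambda>x y. antipode (x * c) * y) s * d) t =
        tensor_lift (\<lambda>c d. antipode c * d) (s * t)" for s t
    proof (rule tensor_ext[of _ _ t])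
      fix c d :: 'a
      show "tensor_lift (\<lambda>c d. tensor_lift (\<lambda>x y. antipode (x * c) * y) s * d) (c \<otimes> d) =
          tensor_lift (\<lambda>c d. antipode c * d) (s * (c \<otimes> d))"
        by (subst tensor_lift_pure, intro hopf_clinear_intros)
          (rule tensor_ext[of _ _ s]; (intro hopf_clinear_intros)?;
            simp add: tensor_mult_tensor tensor_lift_pure hopf_clinear_intros mult.assoc)
    qed (intro hopf_clinear_intros)+
    from this[of "comult a" "comult _"]
    have "tensor_lift (\<lambda>c d. ?f c * d) (comult b) = counit (a * b) *\<^sub>C 1" for b
      by (simp add: algebra_hom_simps(5)[OF comult_hom, symmetric] antipode_left)
    then have "?f b = tensor_lift (\<lambda>c d. (counit (a * c) *\<^sub>C 1) * antipode d) (comult b)"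
      by (intro convolution_cancel f hopf_clinear_intros)
    also have "\<dots> = antipode (counit a *\<^sub>C tensor_lift (\<lambda>c d. counit c *\<^sub>C d) (comult b))"
      by (rule tensor_ext[of _ _ "comult b"]; (intro hopf_clinear_intros)?)
        (simp add: tensor_lift_pure hopf_clinear_intros algebra_hom_simps(5)[OF counit_hom]
          mult_scaleC_left scaleC_scaleC antipode_linear[unfolded clinear_iff])
    finally show ?thesis
      using antipode_linear by (simp add: counit_left clinear_iff)
  qed
  \<comment> \<open>Now \<open>b\<close> is fixed and \<open>a\<close> varies: \<open>step\<close>
    is the convolution of \<open>antipode (_ * b)\<close> with the identity.\<close>
  have "antipode (a * b) = tensor_lift (\<lambda>c d. (counit c *\<^sub>C antipode b) * antipode d) (comult a)"
    by (rule convolution_cancel) (intro hopf_clinear_intros step)+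
  also have "\<dots> = antipode b * antipode (tensor_lift (\<lambda>c d. counit c *\<^sub>C d) (comult a))"
    by (rule tensor_ext[of _ _ "comult a"]; (intro hopf_clinear_intros)?)
      (simp add: tensor_lift_pure hopf_clinear_intros mult_scaleC_left mult_scaleC_right
        antipode_linear[unfolded clinear_iff])
  finally show ?thesis
    by (simp add: counit_left)
qed

end

section \<open>The Hopf algebra structure of the free wreath product\<close>

lemmas wreath_nu_linear = algebra_hom_clinear[OF algebra_hom_wreath_nu]

lemma algebra_hom_wreath_ext:
  assumes "algebra_hom f" "algebra_hom g"
    and "\<And>i a. f (wreath_nu i a) = g (wreath_nu i a)" "\<And>i j. f (wreath_x i j) = g (wreath_x i j)"
  shows "f t = g t"
  by (induction t rule: free_wreath_induct)
    (simp_all add: assms(3,4) algebra_hom_simps[OF assms(1)] algebra_hom_simps[OF assms(2)])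

text \<open>In terms of \<open>wreath_nu_tensor\<close>, the comultiplication of the generator \<open>\<nu>\<^sub>i a\<close> is
  \<open>wreath_nu_tensor i (comult a)\<close>.\<close>

definition wreath_nu_tensor ::
  "'n::finite \<Rightarrow> ('a::complex_unital_algebra, 'a) tensor \<Rightarrow> (('a, 'n) free_wreath, ('a, 'n) free_wreath) tensor"
  where "wreath_nu_tensor i t =
    (\<Sum>k\<in>UNIV. tensor_map (wreath_nu i) (wreath_nu k) t * (wreath_x i k \<otimes> 1))"

lemmas wreath_clinear_intros = clinear_intros clinear_tensor_intros wreath_nu_linear
  clinear_compose[OF wreath_nu_linear]

lemma clinear_wreath_nu_tensor: "clinear (wreath_nu_tensor i)"
  unfolding wreath_nu_tensor_def by (intro wreath_clinear_intros)

lemma wreath_nu_tensor_pure: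
  "wreath_nu_tensor i (a \<otimes> b) = (\<Sum>k\<in>UNIV. (wreath_nu i a * wreath_x i k) \<otimes> wreath_nu k b)"
  by (simp add: wreath_nu_tensor_def tensor_map_pure wreath_nu_linear tensor_mult_tensor)

text \<open>Links the two forms in which the theorem gives the coproduct of
  \<open>wreath_nu i a\<close>; this one is the Sweedler form.\<close>

lemma wreath_nu_tensor_eq_tensor_lift:
  "wreath_nu_tensor i t =
    (\<Sum>k\<in>UNIV. tensor_lift (\<lambda>b c. (wreath_nu i b * wreath_x i k) \<otimes> wreath_nu k c) t)"
proof (rule tensor_ext[of "wreath_nu_tensor i"])
  fix a b
  show "wreath_nu_tensor i (a \<otimes> b) =
      (\<Sum>k\<in>UNIV. tensor_lift (\<lambda>b c. (wreath_nu i b * wreath_x i k) \<otimes> wreath_nu k c) (a \<otimes> b))"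
    by (subst tensor_lift_pure) (intro wreath_clinear_intros | rule wreath_nu_tensor_pure)+
qed (intro wreath_clinear_intros clinear_wreath_nu_tensor)+

text \<open>Used with \<open>z = 1\<close> for the idempotents
  \<open>wreath_x k l \<otimes> 1\<close>, and with \<open>z = wreath_x l i\<close> for the
  commutation relation in the tensor square.\<close>

lemma tensor_map_wreath_nu_commute:
  assumes "\<And>b. wreath_nu l b * z = z * wreath_nu l b"
  shows "tensor_map (wreath_nu k) (wreath_nu l) t * (wreath_x k l \<otimes> z) =
    (wreath_x k l \<otimes> z) * tensor_map (wreath_nu k) (wreath_nu l) t"
  by (rule tensor_ext[of "\<lambda>t. _ t * _"]; (intro wreath_clinear_intros)?)
    (simp add: tensor_map_pure wreath_nu_linear tensor_mult_tensor assms wreath_commute)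

lemma wreath_x_tensor_row:
  "(\<Sum>k\<in>UNIV. wreath_x i k \<otimes> wreath_x k j) * (\<Sum>k\<in>UNIV. wreath_x i k \<otimes> wreath_x k l) =
    (if j = l then \<Sum>k\<in>UNIV. wreath_x i k \<otimes> wreath_x k j else 0)"
  by (simp add: sum_product tensor_mult_tensor wreath_x_row tensor_if)

lemma wreath_x_tensor_column:
  "(\<Sum>k\<in>UNIV. wreath_x j k \<otimes> wreath_x k i) * (\<Sum>k\<in>UNIV. wreath_x l k \<otimes> wreath_x k i) =
    (if j = l then \<Sum>k\<in>UNIV. wreath_x j k \<otimes> wreath_x k i else 0)"
  by (simp add: sum_product tensor_mult_tensor wreath_x_column tensor_if)

lemma wreath_x_tensor_sum:
  "(\<Sum>j\<in>UNIV. \<Sum>k\<in>UNIV. wreath_x i k \<otimes> wreath_x k j) = 1"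
  "(\<Sum>j\<in>UNIV. \<Sum>k\<in>UNIV. wreath_x j k \<otimes> wreath_x k i) = 1"
proof -
  show "(\<Sum>j\<in>UNIV. \<Sum>k\<in>UNIV. wreath_x i k \<otimes> wreath_x k j) = 1"
    by (subst sum.swap) (simp add: tensor_sum_right[symmetric] tensor_sum_left[symmetric]
      wreath_x_row_sum one_tensor_def)
  show "(\<Sum>j\<in>UNIV. \<Sum>k\<in>UNIV. wreath_x j k \<otimes> wreath_x k i) = 1"
    by (subst sum.swap) (simp add: tensor_sum_right[symmetric] tensor_sum_left[symmetric]
      wreath_x_column_sum one_tensor_def)
qed

text \<open>Row orthogonality leaves only the diagonal of the double sum. For
  \<open>t = comult a\<close> this is the coproduct of \<open>wreath_nu k a * wreath_x k i\<close>,
  needed again for coassociativity and for the corepresentations.\<close>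

lemma wreath_nu_tensor_mult_x:
  "wreath_nu_tensor k t * (\<Sum>m\<in>UNIV. wreath_x k m \<otimes> wreath_x m i) =
    (\<Sum>l\<in>UNIV. tensor_map (wreath_nu k) (wreath_nu l) t * (wreath_x k l \<otimes> wreath_x l i))"
  by (simp add: wreath_nu_tensor_def sum_product mult.assoc tensor_mult_tensor wreath_x_row tensor_if
      mult_if)

text \<open>The defining relation of the wreath product has to survive under the comultiplication.
  Both products collapse to diagonal terms, and these agree by
  \<open>tensor_map_wreath_nu_commute\<close>.\<close>

lemma wreath_nu_tensor_commute:
  "wreath_nu_tensor k t * (\<Sum>m\<in>UNIV. wreath_x k m \<otimes> wreath_x m i) =
    (\<Sum>m\<in>UNIV. wreath_x k m \<otimes> wreath_x m i) * wreath_nu_tensor k t"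
proof -
  have "wreath_nu_tensor k t = (\<Sum>l\<in>UNIV. (wreath_x k l \<otimes> 1) * tensor_map (wreath_nu k) (wreath_nu l) t)"
    by (simp add: wreath_nu_tensor_def tensor_map_wreath_nu_commute)
  then have "(\<Sum>m\<in>UNIV. wreath_x k m \<otimes> wreath_x m i) * wreath_nu_tensor k t =
      (\<Sum>l\<in>UNIV. (wreath_x k l \<otimes> wreath_x l i) * tensor_map (wreath_nu k) (wreath_nu l) t)"
    by (simp add: sum_product mult.assoc[symmetric] tensor_mult_tensor wreath_x_row tensor_if mult_if)
  then show ?thesis
    by (simp add: wreath_nu_tensor_mult_x tensor_map_wreath_nu_commute wreath_commute)
qed

lemma algebra_hom_wreath_nu_tensor: "algebra_hom (wreath_nu_tensor i)"
proof -
  have p: "(wreath_x i k \<otimes> 1) * (wreath_x i l \<otimes> 1) = (if k = l then wreath_x i k \<otimes> 1 else 0)" for k l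
    by (simp add: tensor_mult_tensor wreath_x_row tensor_if)
  have sum: "(\<Sum>k\<in>UNIV. wreath_x i k \<otimes> 1) = 1"
    by (simp add: tensor_sum_left[symmetric] wreath_x_row_sum one_tensor_def)
  show ?thesis
    unfolding wreath_nu_tensor_def
    by (rule algebra_hom_sum_idempotents[OF _ p sum])
      (simp_all add: algebra_hom_tensor_map algebra_hom_wreath_nu tensor_map_wreath_nu_commute)
qed

text \<open>With \<open>antipode a\<close> for \<open>a\<close>, the sum is the antipode of
  \<open>wreath_nu i a\<close>. Column orthogonality selects the term \<open>k = j\<close> from
  either side, so \<open>wreath_x j i\<close> commutes with the sum.\<close>

lemma wreath_x_mult_nu_sum:
  "wreath_x j i * (\<Sum>k\<in>UNIV. wreath_nu k a * wreath_x k i) = wreath_x j i * wreath_nu j a"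
  "(\<Sum>k\<in>UNIV. wreath_nu k a * wreath_x k i) * wreath_x j i = wreath_x j i * wreath_nu j a"
proof -
  have "wreath_x j i * (wreath_nu k a * wreath_x k i) =
      (if j = k then wreath_x j i * wreath_nu j a else 0)" for k
    by (simp add: wreath_commute mult.assoc[symmetric] wreath_x_column)
  then show "wreath_x j i * (\<Sum>k\<in>UNIV. wreath_nu k a * wreath_x k i) = wreath_x j i * wreath_nu j a"
    by (simp add: sum_distrib_left)
  show "(\<Sum>k\<in>UNIV. wreath_nu k a * wreath_x k i) * wreath_x j i = wreath_x j i * wreath_nu j a"
    unfolding sum_distrib_right mult.assoc wreath_x_column
    by (simp add: mult_if wreath_commute)
qed

section \<open>The comultiplication, counit and antipode of the wreath product\<close>

context hopf_algebra
begin

text \<open>The choice is harmless: by \<open>algebra_hom_wreath_ext\<close> at most one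
  homomorphism has these values on the generators.\<close>

definition wreath_comult ::
  "('a, 'n::finite) free_wreath \<Rightarrow> (('a, 'n) free_wreath, ('a, 'n) free_wreath) tensor" where
  "wreath_comult = (SOME g. algebra_hom g \<and> (\<forall>i a. g (wreath_nu i a) = wreath_nu_tensor i (comult a)) \<and>
     (\<forall>i j. g (wreath_x i j) = (\<Sum>k\<in>UNIV. wreath_x i k \<otimes> wreath_x k j)))"

lemma wreath_comult:
  fixes i j :: "'n::finite"
  shows "algebra_hom (wreath_comult :: ('a, 'n) free_wreath \<Rightarrow> _)"
  "wreath_comult (wreath_nu i a) = wreath_nu_tensor i (comult a)"
  "wreath_comult (wreath_x i j) = (\<Sum>k\<in>UNIV. wreath_x i k \<otimes> wreath_x k j)"
proof -
  have "\<exists>g :: ('a, 'n) free_wreath \<Rightarrow> (('a, 'n) free_wreath, ('a, 'n) free_wreath) tensor.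
     algebra_hom g \<and> (\<forall>i a. g (wreath_nu i a) = wreath_nu_tensor i (comult a)) \<and>
     (\<forall>i j. g (wreath_x i j) = (\<Sum>k\<in>UNIV. wreath_x i k \<otimes> wreath_x k j))"
    by (intro free_wreath_lift algebra_hom_comp[OF algebra_hom_wreath_nu_tensor comult_hom]
        wreath_x_tensor_row wreath_x_tensor_column wreath_x_tensor_sum wreath_nu_tensor_commute)
  from someI_ex[OF this, folded wreath_comult_def]
  show "algebra_hom (wreath_comult :: ('a, 'n) free_wreath \<Rightarrow> _)"
    "wreath_comult (wreath_nu i a) = wreath_nu_tensor i (comult a)"
    "wreath_comult (wreath_x i j) = (\<Sum>k\<in>UNIV. wreath_x i k \<otimes> wreath_x k j)"
    by blast+
qed

definition wreath_counit :: "('a, 'n::finite) free_wreath \<Rightarrow> complex" where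
  "wreath_counit = (SOME g. algebra_hom g \<and> (\<forall>i a. g (wreath_nu i a) = counit a) \<and>
     (\<forall>i j. g (wreath_x i j) = (if i = j then 1 else 0)))"

lemma wreath_counit:
  fixes i j :: "'n::finite"
  shows "algebra_hom (wreath_counit :: ('a, 'n) free_wreath \<Rightarrow> _)"
  "wreath_counit (wreath_nu i a) = counit a"
  "wreath_counit (wreath_x i j) = (if i = j then 1 else 0)"
proof -
  have "\<exists>g :: ('a, 'n) free_wreath \<Rightarrow> complex.
     algebra_hom g \<and> (\<forall>i a. g (wreath_nu i a) = counit a) \<and>
     (\<forall>i j. g (wreath_x i j) = (if i = j then 1 else 0))"
    by (intro free_wreath_lift counit_hom) simp_all
  from someI_ex[OF this, folded wreath_counit_def]
  show "algebra_hom (wreath_counit :: ('a, 'n) free_wreath \<Rightarrow> _)"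
    "wreath_counit (wreath_nu i a) = counit a"
    "wreath_counit (wreath_x i j) = (if i = j then 1 else 0)"
    by blast+
qed

text \<open>The products are taken in the opposite algebra, to fit
  \<open>algebra_hom_sum_idempotents\<close>. They reverse the factors, and
  \<open>wreath_commute\<close> restores the order in \<open>wreath_antipode_nu\<close>.\<close>

definition wreath_antipode_op :: "('a, 'n::finite) free_wreath \<Rightarrow> ('a, 'n) free_wreath opposite" where
  "wreath_antipode_op = (SOME g. algebra_hom g \<and>
     (\<forall>i a. g (wreath_nu i a) = (\<Sum>k\<in>UNIV. opposite (wreath_nu k (antipode a)) * opposite (wreath_x k i))) \<and>
     (\<forall>i j. g (wreath_x i j) = opposite (wreath_x j i)))"

definition wreath_antipode :: "('a, 'n::finite) free_wreath \<Rightarrow> ('a, 'n) free_wreath" where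
  "wreath_antipode w = of_opposite (wreath_antipode_op w)"

lemma wreath_antipode_op:
  fixes i j :: "'n::finite"
  shows "algebra_hom (wreath_antipode_op :: ('a, 'n) free_wreath \<Rightarrow> _)"
  "wreath_antipode_op (wreath_nu i a) =
     (\<Sum>k\<in>UNIV. opposite (wreath_nu k (antipode a)) * opposite (wreath_x k i))"
  "wreath_antipode_op (wreath_x i j) = opposite (wreath_x j i)"
proof -
  \<comment> \<open>This is where \<open>antipode_mult\<close> enters: the base antipode reverses
    products, and \<open>opposite\<close> reverses them back.\<close>
  have T: "algebra_hom (\<lambda>a. opposite (wreath_nu k (antipode a)))" for k :: 'n
    by (rule algebra_homI)
      (use antipode_linear in \<open>simp_all add: opposite_simps antipode_mult antipode_one
        algebra_hom_simps[OF algebra_hom_wreath_nu] clinear_iff\<close>)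
  have "\<exists>g :: ('a, 'n) free_wreath \<Rightarrow> ('a, 'n) free_wreath opposite. algebra_hom g \<and>
     (\<forall>i a. g (wreath_nu i a) = (\<Sum>k\<in>UNIV. opposite (wreath_nu k (antipode a)) * opposite (wreath_x k i))) \<and>
     (\<forall>i j. g (wreath_x i j) = opposite (wreath_x j i))"
  proof (intro free_wreath_lift algebra_hom_sum_idempotents T)
    fix i k :: 'n and a
    have "(\<Sum>l\<in>UNIV. opposite (wreath_nu l (antipode a)) * opposite (wreath_x l k)) =
        opposite (\<Sum>l\<in>UNIV. wreath_nu l (antipode a) * wreath_x l k)"
      by (simp add: opposite_simps opposite_sum wreath_commute)
    then show "(\<Sum>l\<in>UNIV. opposite (wreath_nu l (antipode a)) * opposite (wreath_x l k)) * opposite (wreath_x i k) =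
        opposite (wreath_x i k) * (\<Sum>l\<in>UNIV. opposite (wreath_nu l (antipode a)) * opposite (wreath_x l k))"
      by (simp add: opposite_simps wreath_x_mult_nu_sum)
  qed (simp_all add: opposite_simps(1) opposite_sum wreath_x_row wreath_x_column wreath_x_row_sum
      wreath_x_column_sum wreath_commute opposite_simps(2,3)[symmetric])
  from someI_ex[OF this, folded wreath_antipode_op_def]
  show "algebra_hom (wreath_antipode_op :: ('a, 'n) free_wreath \<Rightarrow> _)"
    "wreath_antipode_op (wreath_nu i a) =
      (\<Sum>k\<in>UNIV. opposite (wreath_nu k (antipode a)) * opposite (wreath_x k i))"
    "wreath_antipode_op (wreath_x i j) = opposite (wreath_x j i)"
    by blast+
qed

lemma wreath_antipode_linear: "clinear wreath_antipode"
  by (simp add: clinear_iff wreath_antipode_def algebra_hom_simps[OF wreath_antipode_op(1)]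
      plus_opposite.rep_eq scaleC_opposite.rep_eq)

lemma wreath_antipode_mult: "wreath_antipode (v * w) = wreath_antipode w * wreath_antipode v"
  by (simp add: wreath_antipode_def algebra_hom_simps[OF wreath_antipode_op(1)] times_opposite.rep_eq)

lemma wreath_antipode_x: "wreath_antipode (wreath_x i j) = wreath_x j i"
  by (simp add: wreath_antipode_def wreath_antipode_op opposite_inverse)

lemma wreath_antipode_nu:
  "wreath_antipode (wreath_nu i a) = (\<Sum>k\<in>UNIV. wreath_nu k (antipode a) * wreath_x k i)"
  by (simp add: wreath_antipode_def wreath_antipode_op opposite_simps(1) opposite_sum opposite_inverse
      wreath_commute)

lemmas wreath_hopf_clinear_intros = hopf_clinear_intros wreath_nu_linear
  clinear_compose[OF wreath_nu_linear] clinear_wreath_nu_tensor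
  clinear_compose[OF clinear_wreath_nu_tensor]
  wreath_comult(1)[THEN algebra_hom_clinear] clinear_compose[OF wreath_comult(1)[THEN algebra_hom_clinear]]
  wreath_counit(1)[THEN algebra_hom_clinear] clinear_compose[OF wreath_counit(1)[THEN algebra_hom_clinear]]
  wreath_antipode_linear clinear_compose[OF wreath_antipode_linear]

section \<open>The Hopf algebra axioms\<close>

lemma wreath_coassoc_nu:
  "tensor_assoc (tensor_map wreath_comult id (wreath_nu_tensor i (comult a))) =
    tensor_map id wreath_comult (wreath_nu_tensor i (comult a))"
proof -
  \<comment> \<open>Both sides are the image under \<open>?G\<close> of the threefold coproduct of
    \<open>a\<close>. On \<open>a \<otimes> b \<otimes> c\<close>, the value of \<open>?G\<close> is
    the sum over \<open>l\<close> and \<open>k\<close> of \<open>(wreath_nu i a * wreath_x i l)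
    \<otimes> (wreath_nu l b * wreath_x l k) \<otimes> wreath_nu k c\<close>.\<close>
  let ?G = "tensor_lift (\<lambda>a s. \<Sum>l\<in>UNIV. (wreath_nu i a * wreath_x i l) \<otimes> wreath_nu_tensor l s)"
  have G: "cbilinear (\<lambda>a s. \<Sum>l\<in>UNIV. (wreath_nu i a * wreath_x i l) \<otimes> wreath_nu_tensor l s)"
    by (intro wreath_hopf_clinear_intros)
  have right: "tensor_map id wreath_comult (wreath_nu_tensor i t) = ?G (tensor_map id comult t)" for t
  proof (rule tensor_ext[of "\<lambda>t. tensor_map id wreath_comult (wreath_nu_tensor i t)"
        "\<lambda>t. ?G (tensor_map id comult t)"])
    fix a b :: 'a
    show "tensor_map id wreath_comult (wreath_nu_tensor i (a \<otimes> b)) = ?G (tensor_map id comult (a \<otimes> b))"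
      by (simp add: wreath_nu_tensor_pure tensor_map_pure wreath_hopf_clinear_intros
          tensor_lift_pure[OF G] wreath_comult clinear_sum[OF clinear_tensor_map])
  qed (intro wreath_hopf_clinear_intros)+
  have left: "tensor_assoc (tensor_map wreath_comult id (wreath_nu_tensor i t)) =
      ?G (tensor_assoc (tensor_map comult id t))" for t
  proof (rule tensor_ext[of "\<lambda>t. tensor_assoc (tensor_map wreath_comult id (wreath_nu_tensor i t))"
        "\<lambda>t. ?G (tensor_assoc (tensor_map comult id t))"])
    fix a b :: 'a
    \<comment> \<open>The tensor \<open>s\<close> stands for \<open>comult a\<close>, so that a
      second extension from pure tensors is possible.\<close>
    have inner: "tensor_assoc (\<Sum>k\<in>UNIV. (wreath_nu_tensor i s * wreath_comult (wreath_x i k)) \<otimes> wreath_nu k b) =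
        ?G (tensor_assoc (s \<otimes> b))" for s
    proof (rule tensor_ext[of
          "\<lambda>s. tensor_assoc (\<Sum>k\<in>UNIV. (wreath_nu_tensor i s * wreath_comult (wreath_x i k)) \<otimes> wreath_nu k b)"
          "\<lambda>s. ?G (tensor_assoc (s \<otimes> b))"])
      fix c d :: 'a
      have "wreath_nu_tensor i (c \<otimes> d) * wreath_comult (wreath_x i k) =
          (\<Sum>l\<in>UNIV. (wreath_nu i c * wreath_x i l) \<otimes> (wreath_nu l d * wreath_x l k))" for k
        by (simp add: wreath_comult wreath_nu_tensor_mult_x tensor_map_pure wreath_nu_linear
            tensor_mult_tensor)
      then have "tensor_assoc (\<Sum>k\<in>UNIV. (wreath_nu_tensor i (c \<otimes> d) * wreath_comult (wreath_x i k)) \<otimes> wreath_nu k b) =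
          (\<Sum>k\<in>UNIV. \<Sum>l\<in>UNIV. (wreath_nu i c * wreath_x i l) \<otimes> (wreath_nu l d * wreath_x l k) \<otimes> wreath_nu k b)"
        by (simp add: tensor_sum_left clinear_sum[OF clinear_tensor_assoc] tensor_assoc_pure)
      also have "\<dots> = ?G (tensor_assoc ((c \<otimes> d) \<otimes> b))"
        by (subst sum.swap) (simp add: tensor_assoc_pure tensor_lift_pure[OF G] wreath_nu_tensor_pure
            tensor_sum_right)
      finally show "tensor_assoc (\<Sum>k\<in>UNIV. (wreath_nu_tensor i (c \<otimes> d) * wreath_comult (wreath_x i k)) \<otimes> wreath_nu k b) =
          ?G (tensor_assoc ((c \<otimes> d) \<otimes> b))" .
    qed (intro wreath_hopf_clinear_intros)+
    show "tensor_assoc (tensor_map wreath_comult id (wreath_nu_tensor i (a \<otimes> b))) =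
        ?G (tensor_assoc (tensor_map comult id (a \<otimes> b)))"
      using inner[of "comult a"]
      by (simp add: wreath_nu_tensor_pure tensor_map_pure wreath_hopf_clinear_intros
          clinear_sum[OF clinear_tensor_map] algebra_hom_simps(5)[OF wreath_comult(1)] wreath_comult(2))
  qed (intro wreath_hopf_clinear_intros)+
  show ?thesis
    by (simp only: left right coassoc)
qed

lemma wreath_coassoc:
  "tensor_assoc (tensor_map wreath_comult id (wreath_comult w)) =
    tensor_map id wreath_comult (wreath_comult w)"
proof (rule algebra_hom_wreath_ext[of
      "\<lambda>w. tensor_assoc (tensor_map wreath_comult id (wreath_comult w))"
      "\<lambda>w. tensor_map id wreath_comult (wreath_comult w)"])
  fix i j
  have "(\<Sum>k\<in>UNIV. \<Sum>l\<in>UNIV. wreath_x i l \<otimes> wreath_x l k \<otimes> wreath_x k j) =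
      (\<Sum>k\<in>UNIV. \<Sum>l\<in>UNIV. wreath_x i k \<otimes> wreath_x k l \<otimes> wreath_x l j)"
    by (rule sum.swap)
  then show "tensor_assoc (tensor_map wreath_comult id (wreath_comult (wreath_x i j))) =
      tensor_map id wreath_comult (wreath_comult (wreath_x i j))"
    by (simp add: wreath_comult clinear_sum wreath_hopf_clinear_intros tensor_map_pure tensor_sum_left
        tensor_sum_right tensor_assoc_pure)
qed (simp_all only: wreath_comult(2) wreath_coassoc_nu algebra_hom_comp[OF algebra_hom_tensor_assoc]
    algebra_hom_comp[OF algebra_hom_tensor_map] algebra_hom_id wreath_comult(1))

text \<open>Applying the counit to one leg is a homomorphism because its values are scalars. In the
  coproduct of \<open>wreath_nu i a\<close> the factor \<open>wreath_x i k\<close> is sent to 0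
  unless \<open>k = i\<close>.\<close>

lemma wreath_counit_left: "tensor_lift (\<lambda>b c. wreath_counit b *\<^sub>C c) (wreath_comult w) = w"
proof -
  let ?L = "tensor_lift (\<lambda>b c. wreath_counit b *\<^sub>C c)"
  have L: "cbilinear (\<lambda>b c. wreath_counit b *\<^sub>C c)"
    by (intro wreath_hopf_clinear_intros)
  have "algebra_hom ?L"
    by (rule algebra_hom_tensorI[OF clinear_tensor_lift[OF L]])
      (simp_all add: tensor_lift_pure[OF L] algebra_hom_simps[OF wreath_counit(1)] scaleC_one
        mult_scaleC_left mult_scaleC_right scaleC_scaleC)
  then have hom: "algebra_hom (\<lambda>w. ?L (wreath_comult w))"
    by (rule algebra_hom_comp[OF _ wreath_comult(1)])
  have nu: "?L (wreath_nu_tensor i t) = wreath_nu i (tensor_lift (\<lambda>b c. counit b *\<^sub>C c) t)" for i t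
    by (rule tensor_ext[of "\<lambda>t. ?L (wreath_nu_tensor i t)"]; (intro wreath_hopf_clinear_intros)?)
      (simp add: wreath_nu_tensor_pure clinear_sum wreath_hopf_clinear_intros tensor_lift_pure
        algebra_hom_simps[OF wreath_counit(1)] algebra_hom_simps(2)[OF algebra_hom_wreath_nu]
        wreath_counit if_distrib[of "\<lambda>x. x *\<^sub>C _"] mult_if cong: if_cong)
  show ?thesis
    by (rule algebra_hom_wreath_ext[OF hom algebra_hom_id, unfolded id_def])
      (simp_all add: wreath_comult nu counit_left clinear_sum[OF clinear_tensor_lift[OF L]]
        tensor_lift_pure[OF L] wreath_counit if_distrib[of "\<lambda>x. x *\<^sub>C _"] scaleC_one cong: if_cong)
qed

text \<open>Here every \<open>k\<close> contributes on \<open>wreath_nu i a\<close>, and the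
  remaining factors \<open>wreath_x i k\<close> add up to 1.\<close>

lemma wreath_counit_right: "tensor_lift (\<lambda>b c. wreath_counit c *\<^sub>C b) (wreath_comult w) = w"
proof -
  let ?L = "tensor_lift (\<lambda>b c. wreath_counit c *\<^sub>C b)"
  have L: "cbilinear (\<lambda>b c. wreath_counit c *\<^sub>C b)"
    by (intro wreath_hopf_clinear_intros)
  have "algebra_hom ?L"
    by (rule algebra_hom_tensorI[OF clinear_tensor_lift[OF L]])
      (simp_all add: tensor_lift_pure[OF L] algebra_hom_simps[OF wreath_counit(1)] scaleC_one
        mult_scaleC_left mult_scaleC_right scaleC_scaleC mult.commute)
  then have hom: "algebra_hom (\<lambda>w. ?L (wreath_comult w))"
    by (rule algebra_hom_comp[OF _ wreath_comult(1)])
  have nu: "?L (wreath_nu_tensor i t) = wreath_nu i (tensor_lift (\<lambda>b c. counit c *\<^sub>C b) t)" for i t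
    by (rule tensor_ext[of "\<lambda>t. ?L (wreath_nu_tensor i t)"]; (intro wreath_hopf_clinear_intros)?)
      (simp add: wreath_nu_tensor_pure clinear_sum wreath_hopf_clinear_intros tensor_lift_pure
        algebra_hom_simps(2)[OF algebra_hom_wreath_nu] wreath_counit
        complex_vector.scale_sum_right[symmetric] sum_distrib_left[symmetric] wreath_x_row_sum)
  show ?thesis
    by (rule algebra_hom_wreath_ext[OF hom algebra_hom_id, unfolded id_def])
      (simp_all add: wreath_comult nu counit_right clinear_sum[OF clinear_tensor_lift[OF L]]
        tensor_lift_pure[OF L] wreath_counit if_distrib[of "\<lambda>x. x *\<^sub>C _"] scaleC_one cong: if_cong)
qed

text \<open>The left side is not multiplicative in \<open>w\<close>. For a product, however, it
  reads S(w1) (S(v1) v2) w2 in Sweedler notation, and the inner factor is a scalar once the law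
  holds for \<open>v\<close>; hence the law passes to products.\<close>

lemma wreath_antipode_left:
  "tensor_lift (\<lambda>b c. wreath_antipode b * c) (wreath_comult w) = wreath_counit w *\<^sub>C 1"
proof -
  let ?L = "tensor_lift (\<lambda>b c. wreath_antipode b * c)"
  have L: "cbilinear (\<lambda>b c. wreath_antipode b * c)"
    by (intro wreath_hopf_clinear_intros)
  note lin = clinear_tensor_lift[OF L]
  have conv: "?L (s * (b \<otimes> c)) = wreath_antipode b * ?L s * c" for s b c
    by (rule tensor_ext[of "\<lambda>s. ?L (s * (b \<otimes> c))"]; (intro wreath_hopf_clinear_intros)?)
      (simp add: tensor_mult_tensor tensor_lift_pure[OF L] wreath_antipode_mult mult.assoc)
  have conv_mult: "?L (s * t) = e *\<^sub>C ?L t" if "?L s = e *\<^sub>C 1" for s t e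
    by (rule tensor_ext[of "\<lambda>t. ?L (s * t)"]; (intro wreath_hopf_clinear_intros)?)
      (simp add: conv that tensor_lift_pure[OF L] mult_scaleC_left mult_scaleC_right)
  \<comment> \<open>The antipode of \<open>wreath_nu i b * wreath_x i k\<close> begins with
    \<open>wreath_x k i\<close>, which cuts the sum in \<open>wreath_antipode_nu\<close> down to the
    index \<open>k\<close>.\<close>
  have on_nu: "?L (wreath_nu_tensor i t) =
      (\<Sum>k\<in>UNIV. wreath_x k i * wreath_nu k (tensor_lift (\<lambda>b c. antipode b * c) t))" for i t
    by (rule tensor_ext[of "\<lambda>t. ?L (wreath_nu_tensor i t)"]; (intro wreath_hopf_clinear_intros)?)
      (simp add: wreath_nu_tensor_pure clinear_sum wreath_hopf_clinear_intros tensor_lift_pure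
        wreath_antipode_mult wreath_antipode_x wreath_antipode_nu wreath_x_mult_nu_sum
        algebra_hom_simps(5)[OF algebra_hom_wreath_nu] mult.assoc[symmetric])
  show ?thesis
  proof (induction w rule: free_wreath_induct)
    case (nu i a)
    then show ?case
      by (simp add: wreath_comult on_nu antipode_left algebra_hom_simps[OF algebra_hom_wreath_nu]
          mult_scaleC_right complex_vector.scale_sum_right[symmetric] wreath_x_column_sum wreath_counit)
  next
    case (x i j)
    then show ?case
      by (simp add: wreath_comult clinear_sum[OF lin] tensor_lift_pure[OF L] wreath_antipode_x
          wreath_x_row wreath_x_column_sum wreath_counit scaleC_one)
  next
    case (mult v w)
    then show ?case
      by (simp add: algebra_hom_simps[OF wreath_comult(1)] algebra_hom_simps[OF wreath_counit(1)]
          conv_mult[of "wreath_comult v" "wreath_counit v"] scaleC_scaleC)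
  qed (simp add: algebra_hom_simps[OF wreath_comult(1)] algebra_hom_simps[OF wreath_counit(1)]
      lin[unfolded clinear_iff] scaleC_add_left)
qed

text \<open>Mirror image of the previous argument: in v1 (w1 S(w2)) S(v2) the inner factor belongs
  to \<open>w\<close>.\<close>

lemma wreath_antipode_right:
  "tensor_lift (\<lambda>b c. b * wreath_antipode c) (wreath_comult w) = wreath_counit w *\<^sub>C 1"
proof -
  let ?R = "tensor_lift (\<lambda>b c. b * wreath_antipode c)"
  have R: "cbilinear (\<lambda>b c. b * wreath_antipode c)"
    by (intro wreath_hopf_clinear_intros)
  note lin = clinear_tensor_lift[OF R]
  have conv: "?R ((b \<otimes> c) * t) = b * ?R t * wreath_antipode c" for t b c
    by (rule tensor_ext[of "\<lambda>t. ?R ((b \<otimes> c) * t)"]; (intro wreath_hopf_clinear_intros)?)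
      (simp add: tensor_mult_tensor tensor_lift_pure[OF R] wreath_antipode_mult mult.assoc)
  have conv_mult: "?R (s * t) = e *\<^sub>C ?R s" if "?R t = e *\<^sub>C 1" for s t e
    by (rule tensor_ext[of "\<lambda>s. ?R (s * t)"]; (intro wreath_hopf_clinear_intros)?)
      (simp add: conv that tensor_lift_pure[OF R] mult_scaleC_left mult_scaleC_right)
  have on_nu: "?R (wreath_nu_tensor i t) = wreath_nu i (tensor_lift (\<lambda>b c. b * antipode c) t)" for i t
  proof (rule tensor_ext[of "\<lambda>t. ?R (wreath_nu_tensor i t)"]; (intro wreath_hopf_clinear_intros)?)
    fix a b :: 'a
    have "?R (wreath_nu_tensor i (a \<otimes> b)) =
        (\<Sum>k\<in>UNIV. wreath_nu i a * (wreath_x i k * wreath_nu i (antipode b)))"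
      by (simp add: wreath_nu_tensor_pure clinear_sum[OF lin] tensor_lift_pure[OF R] mult.assoc
          wreath_antipode_nu wreath_x_mult_nu_sum)
    also have "\<dots> = wreath_nu i (a * antipode b)"
      by (simp add: sum_distrib_left[symmetric] sum_distrib_right[symmetric] wreath_x_row_sum
          algebra_hom_simps(5)[OF algebra_hom_wreath_nu])
    finally show "?R (wreath_nu_tensor i (a \<otimes> b)) = wreath_nu i (tensor_lift (\<lambda>b c. b * antipode c) (a \<otimes> b))"
      by (simp add: tensor_lift_pure hopf_clinear_intros)
  qed
  show ?thesis
  proof (induction w rule: free_wreath_induct)
    case (nu i a)
    then show ?case
      by (simp add: wreath_comult on_nu antipode_right algebra_hom_simps[OF algebra_hom_wreath_nu]
          wreath_counit)
  next
    case (x i j)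
    then show ?case
      by (simp add: wreath_comult clinear_sum[OF lin] tensor_lift_pure[OF R] wreath_antipode_x
          wreath_x_column wreath_x_row_sum wreath_counit scaleC_one)
  next
    case (mult v w)
    then show ?case
      by (simp add: algebra_hom_simps[OF wreath_comult(1)] algebra_hom_simps[OF wreath_counit(1)]
          conv_mult[of "wreath_comult w" "wreath_counit w"] scaleC_scaleC mult.commute)
  qed (simp add: algebra_hom_simps[OF wreath_comult(1)] algebra_hom_simps[OF wreath_counit(1)]
      lin[unfolded clinear_iff] scaleC_add_left)
qed

lemma hopf_algebra_wreath: "hopf_algebra wreath_comult wreath_counit wreath_antipode"
  by (rule hopf_algebra.intro)
    (rule wreath_comult(1) wreath_counit(1) wreath_coassoc wreath_counit_left wreath_counit_right
      wreath_antipode_linear wreath_antipode_left wreath_antipode_right)+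

end

section \<open>The involution\<close>

definition antilinear :: "('a::complex_vector \<Rightarrow> 'b::complex_vector) \<Rightarrow> bool" where
  "antilinear f \<longleftrightarrow> (\<forall>x y. f (x + y) = f x + f y) \<and> (\<forall>c x. f (c *\<^sub>C x) = cnj c *\<^sub>C f x)"

lemma antilinear_additive: "antilinear f \<Longrightarrow> additive f"
  by (simp add: antilinear_def additive_def)

text \<open>A scalar is conjugated in whichever leg it stands, so \<open>tensor_map\<close> makes
  sense for two conjugate linear maps. The result is additive but conjugate linear, so the proofs
  below use \<open>tensor_induct\<close> instead of \<open>tensor_ext\<close>.\<close>

lemma balanced_antilinear_tensor:
  "antilinear f \<Longrightarrow> antilinear g \<Longrightarrow> balanced (\<lambda>a b. f a \<otimes> g b)"
  by (simp add: antilinear_def balanced_def tensor_add_left tensor_add_right tensor_scaleC_left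
      tensor_scaleC_right)

lemma antilinear_tensor_map_pure:
  "antilinear f \<Longrightarrow> antilinear g \<Longrightarrow> tensor_map f g (a \<otimes> b) = f a \<otimes> g b"
  by (simp add: tensor_map_def tensor_lift_tensor balanced_antilinear_tensor)

lemma additive_antilinear_tensor_map:
  "antilinear f \<Longrightarrow> antilinear g \<Longrightarrow> additive (tensor_map f g)"
  by (simp add: tensor_map_def additive_def tensor_lift_add balanced_antilinear_tensor)

lemma antilinear_tensor_map_mult:
  assumes f: "antilinear f" "\<And>x y. f (x * y) = f y * f x"
    and g: "antilinear g" "\<And>x y. g (x * y) = g y * g x"
  shows "tensor_map f g (s * t) = tensor_map f g t * tensor_map f g s"
proof -
  note add = additive_antilinear_tensor_map[OF f(1) g(1)]
  note simps = additive.add[OF add] additive.zero[OF add] antilinear_tensor_map_pure[OF f(1) g(1)]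
  show ?thesis
  proof (induction s rule: tensor_induct)
    case (tensor a b)
    show ?case
      by (induction t rule: tensor_induct)
        (simp_all add: simps tensor_mult_tensor f(2) g(2) distrib_left distrib_right)
  qed (simp_all add: simps distrib_left distrib_right)
qed

context hopf_star_algebra
begin

lemma antilinear_star: "antilinear star"
  by (simp add: antilinear_def star_add star_scaleC)

lemma star_one: "star 1 = 1"
  using star_mult[of "star 1" 1] by (simp add: star_star)

definition wreath_star_op :: "('a, 'n::finite) free_wreath \<Rightarrow> ('a, 'n) free_wreath opposite conjugate" where
  "wreath_star_op = (SOME g. algebra_hom g \<and>
     (\<forall>i a. g (wreath_nu i a) = conjugate (opposite (wreath_nu i (star a)))) \<and>
     (\<forall>i j. g (wreath_x i j) = conjugate (opposite (wreath_x i j))))"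

definition wreath_star :: "('a, 'n::finite) free_wreath \<Rightarrow> ('a, 'n) free_wreath" where
  "wreath_star w = of_opposite (of_conjugate (wreath_star_op w))"

lemma wreath_star_op:
  fixes i j :: "'n::finite"
  shows "algebra_hom (wreath_star_op :: ('a, 'n) free_wreath \<Rightarrow> _)"
  "wreath_star_op (wreath_nu i a) = conjugate (opposite (wreath_nu i (star a)))"
  "wreath_star_op (wreath_x i j) = conjugate (opposite (wreath_x i j))"
proof -
  have T: "algebra_hom (\<lambda>a. conjugate (opposite (wreath_nu k (star a))))" for k :: 'n
    by (rule algebra_homI)
      (simp_all add: opposite_simps conjugate_simps star_mult star_add star_scaleC star_one
        algebra_hom_simps[OF algebra_hom_wreath_nu])
  have "\<exists>g :: ('a, 'n) free_wreath \<Rightarrow> ('a, 'n) free_wreath opposite conjugate. algebra_hom g \<and>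
     (\<forall>i a. g (wreath_nu i a) = conjugate (opposite (wreath_nu i (star a)))) \<and>
     (\<forall>i j. g (wreath_x i j) = conjugate (opposite (wreath_x i j)))"
    by (intro free_wreath_lift T)
      (simp_all add: opposite_simps(1) opposite_sum conjugate_simps(1) conjugate_sum wreath_x_row
        wreath_x_column wreath_x_row_sum wreath_x_column_sum wreath_commute
        opposite_simps(2,3)[symmetric] conjugate_simps(2,3)[symmetric])
  from someI_ex[OF this, folded wreath_star_op_def]
  show "algebra_hom (wreath_star_op :: ('a, 'n) free_wreath \<Rightarrow> _)"
    "wreath_star_op (wreath_nu i a) = conjugate (opposite (wreath_nu i (star a)))"
    "wreath_star_op (wreath_x i j) = conjugate (opposite (wreath_x i j))"
    by blast+
qed

lemma antilinear_wreath_star: "antilinear wreath_star"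
  by (simp add: antilinear_def wreath_star_def algebra_hom_simps[OF wreath_star_op(1)]
      plus_opposite.rep_eq scaleC_opposite.rep_eq plus_conjugate.rep_eq scaleC_conjugate.rep_eq)

lemma wreath_star_mult: "wreath_star (v * w) = wreath_star w * wreath_star v"
  by (simp add: wreath_star_def algebra_hom_simps[OF wreath_star_op(1)] times_opposite.rep_eq
      times_conjugate.rep_eq)

lemma wreath_star_x: "wreath_star (wreath_x i j) = wreath_x i j"
  by (simp add: wreath_star_def wreath_star_op opposite_inverse conjugate_inverse)

lemma wreath_star_nu: "wreath_star (wreath_nu i a) = wreath_nu i (star a)"
  by (simp add: wreath_star_def wreath_star_op opposite_inverse conjugate_inverse)

text \<open>Both sides are additive and reverse products, so generators decide. The star turns
  \<open>wreath_nu i a * wreath_x i k\<close> into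
  \<open>wreath_x i k * wreath_nu i (star a)\<close>, which \<open>wreath_commute\<close> puts back
  in order.\<close>

lemma wreath_comult_star:
  "wreath_comult (wreath_star w) = tensor_map wreath_star wreath_star (wreath_comult w)"
proof -
  note add = additive_antilinear_tensor_map[OF antilinear_star antilinear_star]
  note wadd = additive_antilinear_tensor_map[OF antilinear_wreath_star antilinear_wreath_star]
  note simps = additive.add[OF add] additive.zero[OF add] additive.add[OF wadd]
    additive.zero[OF wadd] additive.sum[OF wadd]
    antilinear_tensor_map_pure[OF antilinear_star antilinear_star]
    antilinear_tensor_map_pure[OF antilinear_wreath_star antilinear_wreath_star]
  have on_nu: "wreath_nu_tensor i (tensor_map star star t) =
      tensor_map wreath_star wreath_star (wreath_nu_tensor i t)" for i t
    by (induction t rule: tensor_induct)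
      (simp_all add: simps algebra_hom_simps[OF algebra_hom_wreath_nu_tensor] wreath_nu_tensor_pure
        wreath_star_mult wreath_star_nu wreath_star_x wreath_commute)
  show ?thesis
    by (induction w rule: free_wreath_induct)
      (simp_all add: simps wreath_star_nu wreath_star_x wreath_star_mult comult_star on_nu wreath_comult(2,3)
        algebra_hom_simps[OF wreath_comult(1)] additive.add[OF antilinear_additive[OF antilinear_wreath_star]]
        antilinear_tensor_map_mult antilinear_wreath_star)
qed

lemma hopf_star_algebra_wreath:
  "hopf_star_algebra wreath_comult wreath_counit wreath_antipode wreath_star"
proof (rule hopf_star_algebra.intro[OF hopf_algebra_wreath], rule hopf_star_algebra_axioms.intro)
  fix v w :: "('a, 'b::finite) free_wreath" and c
  show add: "wreath_star (v + w) = wreath_star v + wreath_star w"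
    and "wreath_star (c *\<^sub>C w) = cnj c *\<^sub>C wreath_star w" for v w :: "('a, 'b) free_wreath"
    by (simp_all add: antilinear_wreath_star[unfolded antilinear_def])
  show "wreath_star (wreath_star w) = w"
    by (induction w rule: free_wreath_induct)
      (simp_all add: add wreath_star_mult wreath_star_nu wreath_star_x star_star)
qed (rule wreath_star_mult wreath_comult_star)+

end

section \<open>Unitary corepresentations\<close>

lemma unital_subalgebra_hull: "unital_subalgebra (unital_subalgebra hull S)"
  by (rule hull_in) (auto simp: unital_subalgebra_def complex_vector.subspace_def)

lemma sum_blocks:
  fixes N d :: nat
  assumes "bij_betw e {..<N} (UNIV :: 'n::finite set)"
  shows "(\<Sum>s<N * d. f (e (s div d)) (s mod d)) = (\<Sum>k\<in>UNIV. \<Sum>s<d. f k s)"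
proof -
  have "(\<Sum>s<N * d. f (e (s div d)) (s mod d)) = (\<Sum>m<N. \<Sum>s=m * d..<m * d + d. f (e (s div d)) (s mod d))"
    by (rule sum.nat_group[symmetric])
  also have "\<dots> = (\<Sum>m<N. \<Sum>s<d. f (e m) s)"
  proof (rule sum.cong)
    fix m
    have "(\<Sum>s=m * d..<m * d + d. f (e (s div d)) (s mod d)) =
        (\<Sum>s=0..<d. f (e ((s + m * d) div d)) ((s + m * d) mod d))"
      using sum.shift_bounds_nat_ivl[of "\<lambda>s. f (e (s div d)) (s mod d)" 0 "m * d" d]
      by (simp add: add.commute)
    also have "\<dots> = (\<Sum>s<d. f (e m) s)"
      by (intro sum.cong) auto
    finally show "(\<Sum>s=m * d..<m * d + d. f (e (s div d)) (s mod d)) = (\<Sum>s<d. f (e m) s)" .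
  qed simp
  also have "\<dots> = (\<Sum>k\<in>UNIV. \<Sum>s<d. f k s)"
    by (rule sum.reindex_bij_betw[OF assms])
  finally show ?thesis .
qed

text \<open>The row indices of \<open>(\<nu>\<^sub>i(u\<^sub>p\<^sub>q) x\<^sub>i\<^sub>j)\<close> are the pairs \<open>(i, p)\<close>; the number \<open>k\<close> encodes the pair
  with \<open>i = e (k div d)\<close> and \<open>p = k mod d\<close>.\<close>

definition wreath_matrix ::
  "(nat \<Rightarrow> 'n::finite) \<Rightarrow> nat \<Rightarrow> (nat \<Rightarrow> nat \<Rightarrow> 'a::complex_unital_algebra) \<Rightarrow> nat \<Rightarrow> nat \<Rightarrow> ('a, 'n) free_wreath"
  where "wreath_matrix e d u k l =
    wreath_nu (e (k div d)) (u (k mod d) (l mod d)) * wreath_x (e (k div d)) (e (l div d))"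

lemma block_index:
  fixes k l d N :: nat
  assumes "k < N * d" "l < N * d" "inj_on e {..<N}"
  shows "k div d < N" "l div d < N" "k mod d < d" "l mod d < d"
    "k = l \<longleftrightarrow> e (k div d) = e (l div d) \<and> k mod d = l mod d"
proof -
  \<comment> \<open>The bound on \<open>k\<close> excludes \<open>d = 0\<close>, where
    \<open>div\<close> and \<open>mod\<close> would not describe a position in a block.\<close>
  have "d > 0"
    using assms(1) by (cases d) auto
  then show 1: "k div d < N" "l div d < N" "k mod d < d" "l mod d < d"
    using assms(1,2) by (simp_all add: less_mult_imp_div_less)
  have "k = l" if "k div d = l div d" "k mod d = l mod d"
    using that by (metis div_mult_mod_eq)
  then show "k = l \<longleftrightarrow> e (k div d) = e (l div d) \<and> k mod d = l mod d"
    using 1 inj_onD[OF assms(3)] by auto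
qed

context hopf_algebra
begin

text \<open>The coproduct of \<open>wreath_nu i (u p q)\<close> alone has no \<open>wreath_x\<close>
  in its second leg. Multiplying by \<open>wreath_x i j\<close> supplies one, by
  \<open>wreath_nu_tensor_mult_x\<close>, and gives both legs the shape of a matrix entry.\<close>

lemma matrix_corepresentation_wreath_matrix:
  fixes e :: "nat \<Rightarrow> 'n::finite"
  assumes u: "matrix_corepresentation comult counit d u"
    and e: "bij_betw e {..<N} UNIV"
  shows "matrix_corepresentation wreath_comult wreath_counit (N * d) (wreath_matrix e d u)"
  unfolding matrix_corepresentation_def
proof (intro allI impI)
  fix k l assume kl: "k < N * d" "l < N * d"
  define i j p q where "i = e (k div d)" "j = e (l div d)" "p = k mod d" "q = l mod d"
  note idx = block_index[OF kl bij_betw_imp_inj_on[OF e], folded i_j_p_q_def]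
  have pq: "comult (u p q) = (\<Sum>s<d. u p s \<otimes> u s q)" "counit (u p q) = (if p = q then 1 else 0)"
    using u idx(3,4) by (auto simp: matrix_corepresentation_def)
  have "wreath_comult (wreath_matrix e d u k l) =
      (\<Sum>m\<in>UNIV. tensor_map (wreath_nu i) (wreath_nu m) (comult (u p q)) * (wreath_x i m \<otimes> wreath_x m j))"
    by (simp add: wreath_matrix_def i_j_p_q_def algebra_hom_simps(5)[OF wreath_comult(1)]
        wreath_comult(2,3) wreath_nu_tensor_mult_x)
  also have "\<dots> = (\<Sum>m\<in>UNIV. \<Sum>s<d. (wreath_nu i (u p s) * wreath_x i m) \<otimes> (wreath_nu m (u s q) * wreath_x m j))"
    by (simp add: pq clinear_sum[OF clinear_tensor_map] wreath_nu_linear tensor_map_pure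
        tensor_mult_tensor sum_distrib_right)
  also have "\<dots> = (\<Sum>s<N * d. wreath_matrix e d u k s \<otimes> wreath_matrix e d u s l)"
    unfolding wreath_matrix_def i_j_p_q_def[symmetric] by (rule sum_blocks[OF e, symmetric])
  finally show "wreath_comult (wreath_matrix e d u k l) =
      (\<Sum>s<N * d. wreath_matrix e d u k s \<otimes> wreath_matrix e d u s l) \<and>
      wreath_counit (wreath_matrix e d u k l) = (if k = l then 1 else 0)"
    by (simp add: wreath_matrix_def i_j_p_q_def[symmetric] algebra_hom_simps(5)[OF wreath_counit(1)]
        wreath_counit(2,3) pq(2) idx(5))
qed

lemma matrix_corepresentation_wreath_x:
  fixes e :: "nat \<Rightarrow> 'n::finite"
  assumes e: "bij_betw e {..<N} UNIV"
  shows "matrix_corepresentation wreath_comult wreath_counit N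
    (\<lambda>k l. wreath_x (e k) (e l) :: ('a, 'n) free_wreath)"
proof -
  have "(\<Sum>s<N. wreath_x i (e s) \<otimes> wreath_x (e s) j) =
      (\<Sum>m\<in>UNIV. (wreath_x i m :: ('a, 'n) free_wreath) \<otimes> (wreath_x m j :: ('a, 'n) free_wreath))"
    for i j
    by (rule sum.reindex_bij_betw[OF e])
  then show ?thesis
    by (simp add: matrix_corepresentation_def wreath_comult(3) wreath_counit(3)
        inj_on_eq_iff[OF bij_betw_imp_inj_on[OF e]])
qed

end

context hopf_star_algebra
begin

text \<open>In the product with the adjoint on the right, column orthogonality first removes the
  blocks with \<open>i \<noteq> j\<close>, and then unitarity of \<open>u\<close> applies. With the
  adjoint on the left, unitarity of \<open>u\<close> applies first, inside
  \<open>wreath_nu m\<close>, and row orthogonality finishes.\<close>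

lemma unitary_wreath_matrix:
  fixes e :: "nat \<Rightarrow> 'n::finite"
  assumes u: "unitary_matrix star d u" and e: "bij_betw e {..<N} UNIV"
  shows "unitary_matrix wreath_star (N * d) (wreath_matrix e d u)"
  unfolding unitary_matrix_def
proof (intro allI impI conjI)
  fix k l assume kl: "k < N * d" "l < N * d"
  define i j p q where "i = e (k div d)" "j = e (l div d)" "p = k mod d" "q = l mod d"
  note idx = block_index[OF kl bij_betw_imp_inj_on[OF e], folded i_j_p_q_def]
  have pq: "(\<Sum>s<d. u p s * star (u q s)) = (if p = q then 1 else 0)"
    "(\<Sum>s<d. star (u s p) * u s q) = (if p = q then 1 else 0)"
    using u idx(3,4) by (auto simp: unitary_matrix_def)
  note hom = algebra_hom_simps[OF algebra_hom_wreath_nu]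
  have "(\<Sum>s<N * d. wreath_matrix e d u k s * wreath_star (wreath_matrix e d u l s)) =
      (\<Sum>m\<in>UNIV. \<Sum>s<d. wreath_nu i (u p s) * wreath_x i m *
        wreath_star (wreath_nu j (u q s) * wreath_x j m))"
    unfolding wreath_matrix_def i_j_p_q_def[symmetric] by (rule sum_blocks[OF e])
  also have "\<dots> = (\<Sum>m\<in>UNIV. \<Sum>s<d. if i = j then wreath_x i m * wreath_nu i (u p s * star (u q s)) else 0)"
  proof (intro sum.cong refl)
    fix m s
    have "wreath_nu i (u p s) * wreath_x i m * wreath_star (wreath_nu j (u q s) * wreath_x j m) =
        wreath_nu i (u p s) * (wreath_x i m * wreath_x j m) * wreath_nu j (star (u q s))"
      by (simp add: wreath_star_mult wreath_star_x wreath_star_nu mult.assoc)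
    then show "wreath_nu i (u p s) * wreath_x i m * wreath_star (wreath_nu j (u q s) * wreath_x j m) =
        (if i = j then wreath_x i m * wreath_nu i (u p s * star (u q s)) else 0)"
      unfolding wreath_x_column by (simp only:) (simp add: wreath_commute hom mult.assoc[symmetric])
  qed
  also have "\<dots> = (if i = j then (\<Sum>m\<in>UNIV. wreath_x i m) * wreath_nu i (\<Sum>s<d. u p s * star (u q s)) else 0)"
    by (simp add: hom(7) sum_product)
  also have "\<dots> = (if k = l then 1 else 0)"
    by (simp only: wreath_x_row_sum pq) (simp add: idx(5) hom)
  finally show "(\<Sum>s<N * d. wreath_matrix e d u k s * wreath_star (wreath_matrix e d u l s)) =
      (if k = l then 1 else 0)" .
  have "(\<Sum>s<N * d. wreath_star (wreath_matrix e d u s k) * wreath_matrix e d u s l) =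
      (\<Sum>m\<in>UNIV. \<Sum>s<d. wreath_star (wreath_nu m (u s p) * wreath_x m i) *
        (wreath_nu m (u s q) * wreath_x m j))"
    unfolding wreath_matrix_def i_j_p_q_def[symmetric] by (rule sum_blocks[OF e])
  also have "\<dots> = (\<Sum>m\<in>UNIV. wreath_x m i * wreath_nu m (\<Sum>s<d. star (u s p) * u s q) * wreath_x m j)"
    by (simp add: wreath_star_mult wreath_star_x wreath_star_nu mult.assoc hom sum_distrib_left
        sum_distrib_right)
  also have "\<dots> = (\<Sum>m\<in>UNIV. if p = q then wreath_x m i * wreath_x m j else 0)"
    by (simp add: pq hom)
  also have "\<dots> = (if k = l then 1 else 0)"
    by (cases "p = q") (simp_all add: wreath_x_row idx(5) wreath_x_column_sum)
  finally show "(\<Sum>s<N * d. wreath_star (wreath_matrix e d u s k) * wreath_matrix e d u s l) =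
      (if k = l then 1 else 0)" .
qed

lemma unitary_wreath_x:
  fixes e :: "nat \<Rightarrow> 'n::finite"
  assumes e: "bij_betw e {..<N} UNIV"
  shows "unitary_matrix wreath_star N (\<lambda>k l. wreath_x (e k) (e l) :: ('a, 'n) free_wreath)"
proof -
  have "(\<Sum>s<N. wreath_x i (e s)) = (\<Sum>m\<in>UNIV. wreath_x i m :: ('a, 'n) free_wreath)"
    "(\<Sum>s<N. wreath_x (e s) i) = (\<Sum>m\<in>UNIV. wreath_x m i :: ('a, 'n) free_wreath)" for i
    by (rule sum.reindex_bij_betw[OF e])+
  then show ?thesis
    by (simp add: unitary_matrix_def wreath_star_x inj_on_eq_iff[OF bij_betw_imp_inj_on[OF e]]
        wreath_x_row wreath_x_column wreath_x_row_sum wreath_x_column_sum)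
qed

end

lemma (in cqg_algebra) cqg_algebra_wreath:
  "cqg_algebra wreath_comult wreath_counit wreath_antipode
     (wreath_star :: ('a, 'n::finite) free_wreath \<Rightarrow> _)"
proof (rule cqg_algebra.intro[OF hopf_star_algebra_wreath], rule cqg_algebra_axioms.intro)
  obtain F where F: "\<And>d u. (d, u) \<in> F \<Longrightarrow> matrix_corepresentation comult counit d u \<and> unitary_matrix star d u"
    and gen: "unital_subalgebra hull {u k l | d u k l. (d, u) \<in> F \<and> k < d \<and> l < d} = UNIV"
    using generated_by_coefficients by auto
  define N where "N = card (UNIV :: 'n set)"
  obtain e :: "nat \<Rightarrow> 'n" where e: "bij_betw e {..<N} UNIV"
    unfolding N_def using ex_bij_betw_nat_finite[of "UNIV :: 'n set"] by (auto simp: lessThan_atLeast0)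
  have surj: "\<exists>m<N. e m = i" for i
    using e unfolding bij_betw_def by (metis UNIV_I image_iff lessThan_iff)
  \<comment> \<open>The matrix of the \<open>wreath_x i j\<close> is added by hand because
    \<open>F\<close> need not provide it: \<open>F\<close> may even be empty when the base algebra
    is spanned by 1.\<close>
  define G :: "(nat \<times> (nat \<Rightarrow> nat \<Rightarrow> ('a, 'n) free_wreath)) set" where
    "G = insert (N, \<lambda>k l. wreath_x (e k) (e l)) ((\<lambda>(d, u). (N * d, wreath_matrix e d u)) ` F)"
  have "matrix_corepresentation wreath_comult wreath_counit d u \<and> unitary_matrix wreath_star d u"
    if "(d, u) \<in> G" for d u
    using that F e unfolding G_def
    by (auto simp: matrix_corepresentation_wreath_matrix matrix_corepresentation_wreath_x
        unitary_wreath_matrix unitary_wreath_x)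
  moreover
  let ?C = "{u k l | d u k l. (d, u) \<in> G \<and> k < d \<and> l < d}"
  let ?B = "unital_subalgebra hull ?C"
  have C: "u k l \<in> ?B" if "(d, u) \<in> G" "k < d" "l < d" for d u k l
    by (rule hull_inc) (use that in blast)
  have B: "unital_subalgebra ?B"
    by (rule unital_subalgebra_hull)
  have sub: "complex_vector.subspace ?B" and B1: "1 \<in> ?B"
    and B_mult: "\<And>x y. x \<in> ?B \<Longrightarrow> y \<in> ?B \<Longrightarrow> x * y \<in> ?B"
    using B by (auto simp: unital_subalgebra_def)
  have x: "wreath_x i j \<in> ?B" for i j
  proof -
    obtain k l where "k < N" "e k = i" "l < N" "e l = j"
      using surj by blast
    then show ?thesis
      using C[of N "\<lambda>k l. wreath_x (e k) (e l)" k l] by (simp add: G_def)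
  qed
  have nu: "wreath_nu i a \<in> ?B" for i a
  proof -
    have coeff: "wreath_nu i (u p q) \<in> ?B" if u: "(d, u) \<in> F" "p < d" "q < d" for d u p q
    proof -
      have "wreath_nu i (u p q) * wreath_x i j \<in> ?B" for j
      proof -
        obtain k l where kl: "k < N" "e k = i" "l < N" "e l = j"
          using surj by blast
        have "(N * d, wreath_matrix e d u) \<in> G"
          using u by (force simp: G_def)
        \<comment> \<open>The entry wanted has row \<open>k * d + p\<close> and column
          \<open>l * d + q\<close>; both must be legal indices.\<close>
        moreover have "m * d + r < N * d" if "m < N" "r < d" for m r
        proof -
          have "m * d + r < Suc m * d"
            using that by simp
          also have "\<dots> \<le> N * d"
            using that by (intro mult_le_mono1) simp
          finally show ?thesis .
        qed
        ultimately have "wreath_matrix e d u (k * d + p) (l * d + q) \<in> ?B"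
          using kl u by (intro C) auto
        then show ?thesis
          using kl u by (simp add: wreath_matrix_def)
      qed
      then have "(\<Sum>j\<in>UNIV. wreath_nu i (u p q) * wreath_x i j) \<in> ?B"
        by (intro complex_vector.subspace_sum[OF sub])
      then show ?thesis
        by (simp add: sum_distrib_left[symmetric] wreath_x_row_sum)
    qed
    \<comment> \<open>The preimage of a subalgebra under the homomorphism \<open>wreath_nu i\<close>
      is a subalgebra; by \<open>coeff\<close> it contains the coefficients from \<open>F\<close>,
      which generate the base algebra.\<close>
    have "unital_subalgebra {a. wreath_nu i a \<in> ?B}"
      using sub B1 B_mult
      by (simp add: unital_subalgebra_def complex_vector.subspace_def
          algebra_hom_simps[OF algebra_hom_wreath_nu])
    then have "unital_subalgebra hull {u k l | d u k l. (d, u) \<in> F \<and> k < d \<and> l < d} \<subseteq> {a. wreath_nu i a \<in> ?B}"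
      by (intro hull_minimal) (use coeff in auto)
    with gen show ?thesis by auto
  qed
  have "w \<in> ?B" for w
    by (induction w rule: free_wreath_induct)
      (use x nu B_mult complex_vector.subspace_add[OF sub] in auto)
  then have "?B = UNIV" by blast
  ultimately show "\<exists>F. (\<forall>(d, u)\<in>F. matrix_corepresentation wreath_comult wreath_counit d u \<and>
      unitary_matrix (wreath_star :: ('a, 'n) free_wreath \<Rightarrow> _) d u) \<and>
      unital_subalgebra hull {u k l | d u k l. (d, u) \<in> F \<and> k < d \<and> l < d} = UNIV"
    by (intro exI[of _ G]) auto
qed

theorem theorem2p3:
  fixes comult :: "'a::complex_unital_algebra \<Rightarrow> ('a, 'a) tensor"
    and counit :: "'a \<Rightarrow> complex"
    and antipode :: "'a \<Rightarrow> 'a"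
  assumes "hopf_algebra comult counit antipode"
  shows "\<exists>(\<Delta> :: ('a, 'n::finite) free_wreath \<Rightarrow> (('a, 'n) free_wreath, ('a, 'n) free_wreath) tensor) \<epsilon> S.
    hopf_algebra \<Delta> \<epsilon> S \<and>
    (\<forall>i j. \<Delta> (wreath_x i j) = (\<Sum>k\<in>UNIV. wreath_x i k \<otimes> wreath_x k j)) \<and>
    (\<forall>i a. \<Delta> (wreath_nu i a) = (\<Sum>k\<in>UNIV. tensor_map (wreath_nu i) (wreath_nu k) (comult a) * (wreath_x i k \<otimes> 1))) \<and>
    (\<forall>i a. \<Delta> (wreath_nu i a) = (\<Sum>k\<in>UNIV. tensor_lift (\<lambda>b c. (wreath_nu i b * wreath_x i k) \<otimes> wreath_nu k c) (comult a))) \<and>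
    (\<forall>i j. \<epsilon> (wreath_x i j) = (if i = j then 1 else 0)) \<and>
    (\<forall>i a. \<epsilon> (wreath_nu i a) = counit a) \<and>
    (\<forall>i j. S (wreath_x i j) = wreath_x j i) \<and>
    (\<forall>i a. S (wreath_nu i a) = (\<Sum>k\<in>UNIV. wreath_nu k (antipode a) * wreath_x k i)) \<and>
    (\<forall>star. hopf_star_algebra comult counit antipode star \<longrightarrow>
      (\<exists>star'. hopf_star_algebra \<Delta> \<epsilon> S star' \<and>
        (\<forall>i j. star' (wreath_x i j) = wreath_x i j) \<and>
        (\<forall>i a. star' (wreath_nu i a) = wreath_nu i (star a)) \<and>
        (cqg_algebra comult counit antipode star \<longrightarrow> cqg_algebra \<Delta> \<epsilon> S star')))"
proof -
  interpret hopf_algebra comult counit antipode by fact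
  \<comment> \<open>The three structure maps come from the Hopf algebra data alone, so the same ones
    serve for every involution of the base algebra.\<close>
  have star: "\<exists>star'. hopf_star_algebra wreath_comult wreath_counit wreath_antipode star' \<and>
        (\<forall>i j. star' (wreath_x i j) = (wreath_x i j :: ('a, 'n) free_wreath)) \<and>
        (\<forall>i a. star' (wreath_nu i a) = wreath_nu i (star a)) \<and>
        (cqg_algebra comult counit antipode star \<longrightarrow>
          cqg_algebra wreath_comult wreath_counit wreath_antipode star')"
    if "hopf_star_algebra comult counit antipode star" for star
  proof -
    interpret hopf_star_algebra comult counit antipode star by fact
    show ?thesis
      using hopf_star_algebra_wreath wreath_star_x wreath_star_nu cqg_algebra.cqg_algebra_wreath
      by blast
  qed
  show ?thesis
    by (intro exI[of _ wreath_comult] exI[of _ wreath_counit] exI[of _ wreath_antipode] conjI allI impI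
        hopf_algebra_wreath wreath_comult(3) wreath_counit(2,3) wreath_antipode_x wreath_antipode_nu star)
      (simp_all only: wreath_comult(2) wreath_nu_tensor_def wreath_nu_tensor_eq_tensor_lift[symmetric])
qed

end
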